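(* Let $p$ be a prime and let $P$ be a $p$-group of nilpotence class at most $3$. Let $\chi\in\mathrm{Irr}(P)$ and $x\in\mathrm{Supp}(\chi)$. Let $h(x)$ be the size of the conjugacy class of $x$ in $P$. Then: (1) If $\chi$ is faithful, then $\frac{\chi(x)\sqrt{h(x)}}{\chi(1)}$ is a root of unity. (2) If $\chi$ is faithful, then $\mathrm{Supp}(\chi)$ contains exactly $|P|/\chi(1)^2$ conjugacy classes of $P$. (3) If $p$ is odd, then $x^m\in\mathrm{Supp}(\chi)$ for all $m\in\mathbb Z$. (4) If $p$ is odd, then the order of $x$ divides $|P|/\chi(1)^2$.
   Context: A $p$-group is a finite group whose order is a power of the prime $p$. $\mathrm{Irr}(P)$ denotes the set of complex irreducible characters of $P$. For $\chi\in\mathrm{Irr}(P)$, the support of $\chi$ is $\mathrm{Supp}(\chi)=\{g\in P:\chi(g)\neq 0\}$; it is a union of conjugacy classes of $P$. A character is faithful if its kernel $\{g\in P:\chi(g)=\chi(1)\}$ is trivial. *)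

theory Defs
  imports
    Complex_Main
    "HOL-Algebra.Generated_Groups"
    "HOL-Algebra.Group_Action"
    "HOL-Algebra.Multiplicative_Group"
    "Jordan_Normal_Form.VS_Connect"
begin

definition p_group :: "nat \<Rightarrow> ('a, 'b) monoid_scheme \<Rightarrow> bool" where
  "p_group p G \<longleftrightarrow> group G \<and> finite (carrier G) \<and> (\<exists>k. Coset.order G = p ^ k)"

definition commutator_subgroup :: "('a, 'b) monoid_scheme \<Rightarrow> 'a set \<Rightarrow> 'a set \<Rightarrow> 'a set" where
  "commutator_subgroup G H K =
     generate G (\<Union>h\<in>H. \<Union>k\<in>K. {h \<otimes>\<^bsub>G\<^esub> k \<otimes>\<^bsub>G\<^esub> inv\<^bsub>G\<^esub> h \<otimes>\<^bsub>G\<^esub> inv\<^bsub>G\<^esub> k})"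

text \<open>The indexing starts at 0: \<open>lower_central G i\<close> is the term usually written
  \<open>\<gamma>\<close> with subscript \<open>i + 1\<close>, so class at most \<open>c\<close> means that \<open>lower_central G c\<close> is trivial.\<close>

primrec lower_central :: "('a, 'b) monoid_scheme \<Rightarrow> nat \<Rightarrow> 'a set" where
  "lower_central G 0 = carrier G"
| "lower_central G (Suc i) = commutator_subgroup G (lower_central G i) (carrier G)"

definition nilpotent_class_le :: "('a, 'b) monoid_scheme \<Rightarrow> nat \<Rightarrow> bool" where
  "nilpotent_class_le G c \<longleftrightarrow> lower_central G c = {\<one>\<^bsub>G\<^esub>}"

definition conj_action :: "('a, 'b) monoid_scheme \<Rightarrow> 'a \<Rightarrow> 'a \<Rightarrow> 'a" where
  "conj_action G = (\<lambda>g. \<lambda>h\<in>carrier G. g \<otimes>\<^bsub>G\<^esub> h \<otimes>\<^bsub>G\<^esub> inv\<^bsub>G\<^esub> g)"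

definition conj_class :: "('a, 'b) monoid_scheme \<Rightarrow> 'a \<Rightarrow> 'a set" where
  "conj_class G x = orbit G (conj_action G) x"

definition conj_classes :: "('a, 'b) monoid_scheme \<Rightarrow> 'a set set" where
  "conj_classes G = orbits G (carrier G) (conj_action G)"

abbreviation GL_complex :: "nat \<Rightarrow> complex mat monoid" where
  "GL_complex n \<equiv> units_of (ring_mat TYPE(complex) n ())"

definition mat_trace :: "complex mat \<Rightarrow> complex" where
  "mat_trace A = (\<Sum>i<dim_row A. A $$ (i, i))"

definition representation ::
  "('a, 'b) monoid_scheme \<Rightarrow> nat \<Rightarrow> ('a \<Rightarrow> complex mat) \<Rightarrow> bool" where
  "representation G n \<rho> \<longleftrightarrow> \<rho> \<in> hom G (GL_complex n)"

definition invariant_subspace ::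
  "('a, 'b) monoid_scheme \<Rightarrow> nat \<Rightarrow> ('a \<Rightarrow> complex mat) \<Rightarrow> complex vec set \<Rightarrow> bool" where
  "invariant_subspace G n \<rho> W \<longleftrightarrow>
     VectorSpace.subspace class_ring W (module_vec TYPE(complex) n) \<and>
     (\<forall>g\<in>carrier G. \<forall>w\<in>W. \<rho> g *\<^sub>v w \<in> W)"

definition irreducible_representation ::
  "('a, 'b) monoid_scheme \<Rightarrow> nat \<Rightarrow> ('a \<Rightarrow> complex mat) \<Rightarrow> bool" where
  "irreducible_representation G n \<rho> \<longleftrightarrow>
     representation G n \<rho> \<and> n > 0 \<and>
     (\<forall>W. invariant_subspace G n \<rho> W \<longrightarrow> W = {0\<^sub>v n} \<or> W = carrier_vec n)"

text \<open>Characters are functions on \<open>carrier G\<close>, represented as extensional functions.\<close>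

definition character :: "('a, 'b) monoid_scheme \<Rightarrow> ('a \<Rightarrow> complex mat) \<Rightarrow> 'a \<Rightarrow> complex" where
  "character G \<rho> = (\<lambda>g\<in>carrier G. mat_trace (\<rho> g))"

definition Irr :: "('a, 'b) monoid_scheme \<Rightarrow> ('a \<Rightarrow> complex) set" where
  "Irr G = {character G \<rho> | n \<rho>. irreducible_representation G n \<rho>}"

definition Supp :: "('a, 'b) monoid_scheme \<Rightarrow> ('a \<Rightarrow> complex) \<Rightarrow> 'a set" where
  "Supp G \<chi> = {g \<in> carrier G. \<chi> g \<noteq> 0}"

definition char_kernel :: "('a, 'b) monoid_scheme \<Rightarrow> ('a \<Rightarrow> complex) \<Rightarrow> 'a set" where
  "char_kernel G \<chi> = {g \<in> carrier G. \<chi> g = \<chi> \<one>\<^bsub>G\<^esub>}"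

definition faithful_char :: "('a, 'b) monoid_scheme \<Rightarrow> ('a \<Rightarrow> complex) \<Rightarrow> bool" where
  "faithful_char G \<chi> \<longleftrightarrow> char_kernel G \<chi> = {\<one>\<^bsub>G\<^esub>}"

definition root_of_unity :: "complex \<Rightarrow> bool" where
  "root_of_unity z \<longleftrightarrow> (\<exists>n::nat. n > 0 \<and> z ^ n = 1)"

end

theory Submission
  imports
    Defs
    "HOL-Number_Theory.Cong"
    "Jordan_Normal_Form.Spectral_Radius"
begin

text \<open>
  Call \<open>x\<close> good if a commutator \<open>[y, x]\<close> lies in the center only when it is trivial. For
  faithful \<open>\<chi>\<close>, an element of the support is good, because conjugating \<open>x\<close> by \<open>y\<close> multiplies
  \<open>\<chi>(x)\<close> by the value of the (faithful) central character at \<open>[y, x]\<close>.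

  In class at most \<open>3\<close> all good elements lie in the abelian normal subgroup
  \<open>D = Z(C)\<close>, where \<open>C\<close> is the centralizer of the second center. Averaging over \<open>P\<close> and applying
  Schur's lemma to a common eigenvector of \<open>D\<close> with eigencharacter \<open>\<mu>\<close> gives
  \<open>\<chi>(x) = (\<chi>(1) / |P|) \<mu>(x) \<Sum>g. \<mu>([g, x])\<close>. The function \<open>g \<mapsto> \<mu>([g, x])\<close> is quadratic, with
  symmetric bimultiplicative form \<open>\<mu>([g, [h, x]])\<close>, whose radical is the centralizer of \<open>x\<close> when
  \<open>x\<close> is good. So the sum is a Gauss sum: its absolute value is known, and its phase is a root of
  unity. This is (1), and it shows that the support consists of the good elements; (2) then
  follows from the first orthogonality relation.

  Good elements are closed under odd powers by commutator calculus, which gives (3) when \<open>p\<close> is odd.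
  If powers of a good \<open>x\<close> are conjugate, their quotient is a good element of the second center, hence
  central, so they coincide. Thus the order of \<open>x\<close> is at most the number of classes in the support;
  both are powers of \<open>p\<close>, which is (4). For (3) and (4) one replaces \<open>P\<close> by its image under the
  representation.
\<close>

section \<open>Groups of class at most three\<close>

definition commutator :: "('a, 'b) monoid_scheme \<Rightarrow> 'a \<Rightarrow> 'a \<Rightarrow> 'a" where
  "commutator G a b = a \<otimes>\<^bsub>G\<^esub> b \<otimes>\<^bsub>G\<^esub> inv\<^bsub>G\<^esub> a \<otimes>\<^bsub>G\<^esub> inv\<^bsub>G\<^esub> b"

context group
begin

text \<open>Together with associativity and \<open>inv_mult_group\<close>, these cancellations let
  the simplifier bring words to normal form, so the commutator identities that hold in free groups
  are proved by rewriting alone.\<close>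

lemma cancel_inv_mult [simp]:
  "\<lbrakk>x \<in> carrier G; y \<in> carrier G\<rbrakk> \<Longrightarrow> inv x \<otimes> (x \<otimes> y) = y"
  "\<lbrakk>x \<in> carrier G; y \<in> carrier G\<rbrakk> \<Longrightarrow> x \<otimes> (inv x \<otimes> y) = y"
  by (subst m_assoc [symmetric], simp_all)+

lemmas free_group_simps = commutator_def m_assoc inv_mult_group

lemma commutator_closed [simp]:
  "\<lbrakk>a \<in> carrier G; b \<in> carrier G\<rbrakk> \<Longrightarrow> commutator G a b \<in> carrier G"
  by (simp add: commutator_def)

lemma commutator_eq_one_iff:
  assumes "a \<in> carrier G" "b \<in> carrier G"
  shows "commutator G a b = \<one> \<longleftrightarrow> a \<otimes> b = b \<otimes> a"
proof
  assume *: "commutator G a b = \<one>"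
  have "a \<otimes> b = commutator G a b \<otimes> (b \<otimes> a)"
    using assms by (simp add: free_group_simps)
  then show "a \<otimes> b = b \<otimes> a" unfolding * using assms by simp
next
  assume *: "a \<otimes> b = b \<otimes> a"
  show "commutator G a b = \<one>"
    unfolding commutator_def * using assms by (simp add: m_assoc)
qed

lemma commute_mult:
  assumes "a \<in> carrier G" "b \<in> carrier G" "c \<in> carrier G" "a \<otimes> c = c \<otimes> a" "b \<otimes> c = c \<otimes> b"
  shows "(a \<otimes> b) \<otimes> c = c \<otimes> (a \<otimes> b)"
proof -
  have "(a \<otimes> b) \<otimes> c = a \<otimes> (b \<otimes> c)" using assms(1-3) by (rule m_assoc)
  also have "\<dots> = (a \<otimes> c) \<otimes> b" unfolding assms(5) using assms(1-3) by (simp add: m_assoc)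
  also have "\<dots> = c \<otimes> (a \<otimes> b)" unfolding assms(4) using assms(1-3) by (simp add: m_assoc)
  finally show ?thesis .
qed

lemma commute_inv:
  assumes "a \<in> carrier G" "c \<in> carrier G" "a \<otimes> c = c \<otimes> a"
  shows "inv a \<otimes> c = c \<otimes> inv a"
proof -
  have "inv a \<otimes> c = inv a \<otimes> (c \<otimes> a) \<otimes> inv a" using assms(1,2) by (simp add: m_assoc)
  also have "\<dots> = c \<otimes> inv a" unfolding assms(3)[symmetric] using assms(1,2) by (simp add: m_assoc)
  finally show ?thesis .
qed

lemma commute_conj:
  assumes "a \<in> carrier G" "c \<in> carrier G" "a \<otimes> c = c \<otimes> a"
  shows "a \<otimes> c \<otimes> inv a = c"
  unfolding assms(3) using assms(1,2) by (simp add: m_assoc)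

lemma commute_if_conj:
  assumes "a \<in> carrier G" "c \<in> carrier G" "a \<otimes> c \<otimes> inv a = c"
  shows "a \<otimes> c = c \<otimes> a"
proof -
  have "a \<otimes> c = (a \<otimes> c \<otimes> inv a) \<otimes> a" using assms(1,2) by (simp add: m_assoc)
  then show ?thesis unfolding assms(3) .
qed

section \<open>The second center, its centralizer and the good elements\<close>

definition center :: "'a set" where
  "center = {z \<in> carrier G. \<forall>g\<in>carrier G. z \<otimes> g = g \<otimes> z}"

definition second_center :: "'a set" where
  "second_center = {u \<in> carrier G. \<forall>g\<in>carrier G. commutator G g u \<in> center}"

definition cent_second_center :: "'a set" where
  "cent_second_center = {x \<in> carrier G. \<forall>u\<in>second_center. x \<otimes> u = u \<otimes> x}"

definition center_cent :: "'a set" where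
  "center_cent = {x \<in> cent_second_center. \<forall>y\<in>cent_second_center. x \<otimes> y = y \<otimes> x}"

text \<open>Equivalently, the centralizer of \<open>x\<close> modulo the center is no larger than the
  centralizer of \<open>x\<close>.\<close>

definition good :: "'a \<Rightarrow> bool" where
  "good x \<longleftrightarrow> x \<in> carrier G \<and>
     (\<forall>y\<in>carrier G. commutator G y x \<in> center \<longrightarrow> commutator G y x = \<one>)"

lemma centerD: "z \<in> center \<Longrightarrow> z \<in> carrier G" "z \<in> center \<Longrightarrow> g \<in> carrier G \<Longrightarrow> z \<otimes> g = g \<otimes> z"
  by (auto simp: center_def)

lemma center_mult: "z \<in> center \<Longrightarrow> w \<in> center \<Longrightarrow> z \<otimes> w \<in> center"
  unfolding center_def by (blast intro: commute_mult)

lemma center_inv: "z \<in> center \<Longrightarrow> inv z \<in> center"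
  unfolding center_def by (blast intro: commute_inv)

lemma one_in_center: "\<one> \<in> center"
  by (auto simp: center_def)

lemma conj_center: "z \<in> center \<Longrightarrow> g \<in> carrier G \<Longrightarrow> g \<otimes> z \<otimes> inv g = z"
  using centerD(2)[of z g] centerD(1)[of z] commute_conj[of g z] by simp

lemma commutator_inv:
  "\<lbrakk>a \<in> carrier G; b \<in> carrier G\<rbrakk> \<Longrightarrow> inv (commutator G a b) = commutator G b a"
  by (simp add: free_group_simps)

lemma commutator_conj:
  "\<lbrakk>g \<in> carrier G; a \<in> carrier G; b \<in> carrier G\<rbrakk> \<Longrightarrow>
    g \<otimes> commutator G a b \<otimes> inv g = commutator G (g \<otimes> a \<otimes> inv g) (g \<otimes> b \<otimes> inv g)"
  by (simp add: free_group_simps)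

text \<open>The defect [g, [h, x]] of multiplicativity is kept as a separate factor; it later
  becomes the form attached to the quadratic function g |-> \<mu>([g, x]).\<close>

lemma commutator_mult_left:
  "\<lbrakk>g \<in> carrier G; h \<in> carrier G; x \<in> carrier G\<rbrakk> \<Longrightarrow>
    commutator G (g \<otimes> h) x = commutator G g (commutator G h x) \<otimes> commutator G h x \<otimes> commutator G g x"
  by (simp add: free_group_simps)

lemma commutator_mult_right:
  "\<lbrakk>g \<in> carrier G; u \<in> carrier G; w \<in> carrier G\<rbrakk> \<Longrightarrow>
    commutator G g (u \<otimes> w) = commutator G g u \<otimes> (u \<otimes> commutator G g w \<otimes> inv u)"
  by (simp add: free_group_simps)

lemma second_centerD:
  "u \<in> second_center \<Longrightarrow> u \<in> carrier G"
  "u \<in> second_center \<Longrightarrow> g \<in> carrier G \<Longrightarrow> commutator G g u \<in> center"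
  by (auto simp: second_center_def)

lemma center_le_second_center: "z \<in> center \<Longrightarrow> z \<in> second_center"
  using one_in_center commutator_eq_one_iff centerD unfolding second_center_def by (smt (verit) mem_Collect_eq)

text \<open>Here [g, w] is central, so the conjugation by u in \<open>commutator_mult_right\<close>
  disappears. With the companion for the left argument, commutation with the second center is
  bimultiplicative.\<close>

lemma commutator_second_center_mult_right:
  assumes "g \<in> carrier G" "u \<in> second_center" "w \<in> second_center"
  shows "commutator G g (u \<otimes> w) = commutator G g u \<otimes> commutator G g w"
  using assms commutator_mult_right[of g u w] second_centerD[of u] second_centerD[of w]
    conj_center[of "commutator G g w" u] by simp

lemma commutator_second_center_mult_left:
  assumes "g \<in> carrier G" "h \<in> carrier G" "u \<in> second_center"
  shows "commutator G (g \<otimes> h) u = commutator G g u \<otimes> commutator G h u"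
proof -
  have c: "commutator G h u \<in> center" and u: "u \<in> carrier G"
    using assms second_centerD by auto
  have "commutator G g (commutator G h u) = \<one>"
    using c assms centerD by (subst commutator_eq_one_iff) auto
  then show ?thesis
    using commutator_mult_left[of g h u] assms u centerD(2)[OF c, of "commutator G g u"] by simp
qed

lemma second_center_conj:
  assumes "u \<in> second_center" "g \<in> carrier G"
  shows "g \<otimes> u \<otimes> inv g \<in> second_center"
proof -
  have u: "u \<in> carrier G" using assms second_centerD by auto
  have "commutator G h (g \<otimes> u \<otimes> inv g) \<in> center" if h: "h \<in> carrier G" for h
  proof -
    \<comment> \<open>Moving the conjugation onto the first argument leaves a conjugate of a central
      element.\<close>
    have "commutator G h (g \<otimes> u \<otimes> inv g) = g \<otimes> commutator G (inv g \<otimes> h \<otimes> g) u \<otimes> inv g"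
      using u h assms(2) by (simp add: free_group_simps)
    then show ?thesis
      using conj_center second_centerD(2)[OF assms(1), of "inv g \<otimes> h \<otimes> g"] h assms(2) by simp
  qed
  then show ?thesis using u assms(2) by (simp add: second_center_def)
qed

lemma second_center_mult:
  assumes "u \<in> second_center" "w \<in> second_center"
  shows "u \<otimes> w \<in> second_center"
proof -
  have "commutator G g (u \<otimes> w) \<in> center" if g: "g \<in> carrier G" for g
    unfolding commutator_second_center_mult_right[OF g assms]
    using assms g by (intro center_mult second_centerD(2))
  then show ?thesis
    using assms[THEN second_centerD(1)] by (simp add: second_center_def)
qed

lemma second_center_pow:
  assumes "u \<in> second_center"
  shows "u [^] (k::nat) \<in> second_center"
proof (induction k)
  case 0
  then show ?case using center_le_second_center one_in_center by simp
next
  case (Suc k)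
  then show ?case using assms second_center_mult by simp
qed

lemma commutator_second_center_pow_right:
  assumes "g \<in> carrier G" "u \<in> second_center"
  shows "commutator G g (u [^] (k::nat)) = commutator G g u [^] k"
proof (induction k)
  case 0
  then show ?case using assms by (simp add: commutator_def)
next
  case (Suc k)
  then show ?case
    using assms commutator_second_center_mult_right[OF assms(1) second_center_pow[OF assms(2)] assms(2)]
    by simp
qed

lemma commutator_second_center_pow_left:
  assumes "g \<in> carrier G" "u \<in> second_center"
  shows "commutator G (g [^] (k::nat)) u = commutator G g u [^] k"
proof (induction k)
  case 0
  then show ?case using assms second_centerD by (simp add: commutator_def)
next
  case (Suc k)
  then show ?case
    using assms commutator_second_center_mult_left[of "g [^] k" g u] by simp
qed

lemma cent_second_centerD:
  "x \<in> cent_second_center \<Longrightarrow> x \<in> carrier G"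
  "x \<in> cent_second_center \<Longrightarrow> u \<in> second_center \<Longrightarrow> x \<otimes> u = u \<otimes> x"
  by (auto simp: cent_second_center_def)

lemma center_centD:
  "x \<in> center_cent \<Longrightarrow> x \<in> cent_second_center"
  "x \<in> center_cent \<Longrightarrow> x \<in> carrier G"
  "x \<in> center_cent \<Longrightarrow> y \<in> cent_second_center \<Longrightarrow> x \<otimes> y = y \<otimes> x"
  by (auto simp: center_cent_def cent_second_center_def)

text \<open>The last hypothesis is the goal conjugated by \<open>inv g\<close>. It yields that both
  the centralizer of the second center and the center of that centralizer are normal.\<close>

lemma conj_commute_transfer:
  assumes "a \<in> carrier G" "g \<in> carrier G" "b \<in> carrier G"
    and "a \<otimes> (inv g \<otimes> b \<otimes> g) = (inv g \<otimes> b \<otimes> g) \<otimes> a"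
  shows "(g \<otimes> a \<otimes> inv g) \<otimes> b = b \<otimes> (g \<otimes> a \<otimes> inv g)"
proof -
  have "(g \<otimes> a \<otimes> inv g) \<otimes> b = g \<otimes> (a \<otimes> (inv g \<otimes> b \<otimes> g)) \<otimes> inv g"
    using assms(1-3) by (simp add: m_assoc)
  also have "\<dots> = b \<otimes> (g \<otimes> a \<otimes> inv g)"
    unfolding assms(4) using assms(1-3) by (simp add: m_assoc)
  finally show ?thesis .
qed

lemma cent_second_center_conj:
  assumes "x \<in> cent_second_center" "g \<in> carrier G"
  shows "g \<otimes> x \<otimes> inv g \<in> cent_second_center"
proof -
  have "(g \<otimes> x \<otimes> inv g) \<otimes> u = u \<otimes> (g \<otimes> x \<otimes> inv g)" if u: "u \<in> second_center" for u
  proof (rule conj_commute_transfer)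
    show "x \<otimes> (inv g \<otimes> u \<otimes> g) = inv g \<otimes> u \<otimes> g \<otimes> x"
      using cent_second_centerD(2)[OF assms(1) second_center_conj[OF u, of "inv g"]] assms(2) by simp
  qed (use assms(2) cent_second_centerD(1)[OF assms(1)] second_centerD(1)[OF u] in auto)
  then show ?thesis
    using assms(2) cent_second_centerD(1)[OF assms(1)] by (auto simp add: cent_second_center_def)
qed

lemma center_cent_conj:
  assumes "x \<in> center_cent" "g \<in> carrier G"
  shows "g \<otimes> x \<otimes> inv g \<in> center_cent"
proof -
  have "(g \<otimes> x \<otimes> inv g) \<otimes> u = u \<otimes> (g \<otimes> x \<otimes> inv g)" if u: "u \<in> cent_second_center" for u
  proof (rule conj_commute_transfer)
    show "x \<otimes> (inv g \<otimes> u \<otimes> g) = inv g \<otimes> u \<otimes> g \<otimes> x"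
      using center_centD(3)[OF assms(1) cent_second_center_conj[OF u, of "inv g"]] assms(2) by simp
  qed (use assms(2) center_centD(2)[OF assms(1)] cent_second_centerD(1)[OF u] in auto)
  then show ?thesis
    using cent_second_center_conj[OF center_centD(1)[OF assms(1)] assms(2)]
    by (auto simp add: center_cent_def)
qed

lemma cent_second_center_mult:
  "x \<in> cent_second_center \<Longrightarrow> y \<in> cent_second_center \<Longrightarrow> x \<otimes> y \<in> cent_second_center"
  unfolding cent_second_center_def using second_centerD(1) by (blast intro: commute_mult)

lemma cent_second_center_inv:
  "x \<in> cent_second_center \<Longrightarrow> inv x \<in> cent_second_center"
  unfolding cent_second_center_def using second_centerD(1) by (blast intro: commute_inv)

lemma center_cent_mult:
  "x \<in> center_cent \<Longrightarrow> y \<in> center_cent \<Longrightarrow> x \<otimes> y \<in> center_cent"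
  unfolding center_cent_def
  using cent_second_centerD(1) cent_second_center_mult by (blast intro: commute_mult)

lemma center_cent_inv: "x \<in> center_cent \<Longrightarrow> inv x \<in> center_cent"
  unfolding center_cent_def
  using cent_second_centerD(1) cent_second_center_inv by (blast intro: commute_inv)

lemma center_le_center_cent: "z \<in> center \<Longrightarrow> z \<in> center_cent"
  unfolding center_cent_def cent_second_center_def center_def second_center_def by blast

text \<open>[g, x] is a conjugate of x times the inverse of x, and \<open>center_cent\<close> is
  normal and closed under products and inverses.\<close>

lemma commutator_in_center_cent:
  "x \<in> center_cent \<Longrightarrow> g \<in> carrier G \<Longrightarrow> commutator G g x \<in> center_cent"
  unfolding commutator_def using center_cent_conj center_cent_mult center_cent_inv by blast

text \<open>For u in the second center, [x, u] is central; so is its inverse [u, x], which goodness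
  forces to be trivial.\<close>

lemma good_commutes_second_center:
  assumes "good x" "u \<in> second_center"
  shows "x \<otimes> u = u \<otimes> x"
proof -
  have x: "x \<in> carrier G" and u: "u \<in> carrier G"
    using assms second_centerD by (auto simp: good_def)
  have "commutator G u x \<in> center"
    using center_inv[OF second_centerD(2)[OF assms(2) x]] commutator_inv x u by simp
  then have "commutator G u x = \<one>"
    using assms(1) u by (simp add: good_def)
  then show ?thesis using commutator_eq_one_iff x u by auto
qed

text \<open>All commutators [g, x] are central here, and goodness kills them. In
  \<open>odd_ord_dvd\<close> this is applied to the quotient of two conjugate powers.\<close>

lemma good_second_center_imp_center:
  assumes "good x" "x \<in> second_center"
  shows "x \<in> center"
proof -
  have x: "x \<in> carrier G" using assms by (simp add: good_def)
  have "x \<otimes> g = g \<otimes> x" if g: "g \<in> carrier G" for g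
  proof -
    have "commutator G g x = \<one>"
      using assms second_centerD(2)[OF assms(2) g] g by (simp add: good_def)
    then show ?thesis using commutator_eq_one_iff[OF g x] by simp
  qed
  then show ?thesis using x by (simp add: center_def)
qed

end

section \<open>Commutator calculus in class at most three\<close>

locale group_class3 = group +
  assumes commutators_in_second_center:
    "\<lbrakk>a \<in> carrier G; b \<in> carrier G\<rbrakk> \<Longrightarrow> commutator G a b \<in> second_center"
begin

text \<open>Conjugation by g turns x and y into u x and w y with u = [g, x] and w = [g, y] in the
  second center. Since u and w commute with x, y and each other, [u x, w y] is [x, y] conjugated by
  u w, which changes nothing.\<close>

lemma commutator_cent_in_center:
  assumes x: "x \<in> cent_second_center" and y: "y \<in> cent_second_center"
  shows "commutator G x y \<in> center"
proof -
  have xc: "x \<in> carrier G" and yc: "y \<in> carrier G"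
    using x y cent_second_centerD by auto
  have *: "g \<otimes> commutator G x y \<otimes> inv g = commutator G x y" if g: "g \<in> carrier G" for g
  proof -
    define u where "u = commutator G g x"
    define w where "w = commutator G g y"
    have u2: "u \<in> second_center" and w2: "w \<in> second_center"
      using commutators_in_second_center g xc yc by (auto simp: u_def w_def)
    have uc: "u \<in> carrier G" and wc: "w \<in> carrier G" using u2 w2 second_centerD by auto
    \<comment> \<open>The centralizer of the second center is normal, so u itself lies in it and
      commutes with w.\<close>
    have "u = (g \<otimes> x \<otimes> inv g) \<otimes> inv x" by (simp add: u_def commutator_def)
    then have ucc: "u \<in> cent_second_center"
      using cent_second_center_mult cent_second_center_conj cent_second_center_inv x g by simp
    have gx: "g \<otimes> x \<otimes> inv g = u \<otimes> x" and gy: "g \<otimes> y \<otimes> inv g = w \<otimes> y"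
      using g xc yc by (simp_all add: u_def w_def free_group_simps)
    have uw: "u \<otimes> w = w \<otimes> u" using ucc w2 cent_second_centerD by auto
    have xu: "x \<otimes> u = u \<otimes> x" and xw: "x \<otimes> w = w \<otimes> x"
      and yu: "y \<otimes> u = u \<otimes> y" and yw: "y \<otimes> w = w \<otimes> y"
      using x y u2 w2 cent_second_centerD by auto
    have e1: "(u \<otimes> x) \<otimes> (w \<otimes> y) = (u \<otimes> w) \<otimes> (x \<otimes> y)"
    proof -
      have "(u \<otimes> x) \<otimes> (w \<otimes> y) = u \<otimes> (x \<otimes> w) \<otimes> y" using xc yc uc wc by (simp add: m_assoc)
      then show ?thesis unfolding xw using xc yc uc wc by (simp add: m_assoc)
    qed
    have e2: "(w \<otimes> y) \<otimes> (u \<otimes> x) = (u \<otimes> w) \<otimes> (y \<otimes> x)"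
    proof -
      have "(w \<otimes> y) \<otimes> (u \<otimes> x) = w \<otimes> (y \<otimes> u) \<otimes> x" using xc yc uc wc by (simp add: m_assoc)
      also have "\<dots> = (w \<otimes> u) \<otimes> (y \<otimes> x)" unfolding yu using xc yc uc wc by (simp add: m_assoc)
      finally show ?thesis unfolding uw .
    qed
    have "commutator G (u \<otimes> x) (w \<otimes> y)
        = ((u \<otimes> x) \<otimes> (w \<otimes> y)) \<otimes> inv ((w \<otimes> y) \<otimes> (u \<otimes> x))"
      using xc yc uc wc by (simp add: free_group_simps)
    also have "\<dots> = (u \<otimes> w) \<otimes> commutator G x y \<otimes> inv (u \<otimes> w)"
      unfolding e1 e2 using xc yc uc wc by (simp add: free_group_simps)
    also have "\<dots> = commutator G x y"
    proof -
      have "(u \<otimes> w) \<in> second_center" using u2 w2 second_center_mult by simp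
      moreover have "commutator G x y \<in> cent_second_center"
        unfolding commutator_def using x y cent_second_center_mult cent_second_center_inv by simp
      ultimately have "(u \<otimes> w) \<otimes> commutator G x y = commutator G x y \<otimes> (u \<otimes> w)"
        using cent_second_centerD by auto
      then show ?thesis
        using xc yc uc wc commute_conj by simp
    qed
    finally show ?thesis
      using commutator_conj[OF g xc yc] gx gy by simp
  qed
  have "commutator G x y \<otimes> g = g \<otimes> commutator G x y" if g: "g \<in> carrier G" for g
    using commute_if_conj[OF g _ *[OF g]] xc yc by simp
  then show ?thesis using xc yc by (simp add: center_def)
qed

text \<open>A good x commutes with the second center; for y in the centralizer of the second center,
  [y, x] is then central, hence trivial.\<close>

lemma good_in_center_cent:
  assumes "good x"
  shows "x \<in> center_cent"
proof -
  have x: "x \<in> carrier G" using assms by (simp add: good_def)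
  have xc: "x \<in> cent_second_center"
    using x good_commutes_second_center[OF assms] by (simp add: cent_second_center_def)
  have "x \<otimes> y = y \<otimes> x" if y: "y \<in> cent_second_center" for y
  proof -
    have "commutator G y x = \<one>"
      using assms commutator_cent_in_center[OF y xc] cent_second_centerD(1)[OF y]
      by (simp add: good_def)
    then show ?thesis
      using commutator_eq_one_iff x cent_second_centerD(1)[OF y] by auto
  qed
  then show ?thesis using xc by (simp add: center_cent_def)
qed

text \<open>The products g h and h g differ by the left factor k = [g, h] in the second center,
  which commutes with every conjugate of x. So [g h, x] = [h g, x]; expanding both sides by
  \<open>commutator_mult_left\<close> and cancelling the commuting factors [g, x] and [h, x] leaves
  the claim.\<close>

lemma commutator_commutator_sym:
  assumes x: "x \<in> center_cent" and g: "g \<in> carrier G" and h: "h \<in> carrier G"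
  shows "commutator G g (commutator G h x) = commutator G h (commutator G g x)"
proof -
  have xc: "x \<in> carrier G" using x center_centD by auto
  define k where "k = commutator G g h"
  have k: "k \<in> second_center" "k \<in> carrier G"
    using commutators_in_second_center g h by (auto simp: k_def)
  let ?y = "(h \<otimes> g) \<otimes> x \<otimes> inv (h \<otimes> g)"
  have "?y \<in> center_cent" using center_cent_conj x g h by simp
  then have "?y \<otimes> k = k \<otimes> ?y" "?y \<in> carrier G"
    using k center_centD cent_second_centerD by blast+
  then have ky: "k \<otimes> ?y \<otimes> inv k = ?y"
    by (intro commute_conj[OF k(2)]) simp_all
  have "commutator G (g \<otimes> h) x = (k \<otimes> ?y \<otimes> inv k) \<otimes> inv x"
    using g h xc by (simp add: free_group_simps k_def)
  then have eq: "commutator G (g \<otimes> h) x = commutator G (h \<otimes> g) x"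
    unfolding ky by (simp add: commutator_def)
  have comm: "commutator G g x \<otimes> commutator G h x = commutator G h x \<otimes> commutator G g x"
    using commutator_in_center_cent[OF x g] commutator_in_center_cent[OF x h] center_centD
    by auto
  have "commutator G g (commutator G h x) \<otimes> (commutator G h x \<otimes> commutator G g x)
      = commutator G h (commutator G g x) \<otimes> (commutator G h x \<otimes> commutator G g x)"
    using eq commutator_mult_left[OF g h xc] commutator_mult_left[OF h g xc] comm
      g h xc by (simp add: m_assoc)
  then show ?thesis using g h xc by simp
qed

lemma commutator_center_cent_mult_right:
  assumes "x \<in> center_cent" "w \<in> center_cent" "g \<in> carrier G"
  shows "commutator G g (x \<otimes> w) = commutator G g x \<otimes> commutator G g w"
proof -
  have c: "x \<in> carrier G" "w \<in> carrier G" using assms center_centD by auto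
  have "commutator G g w \<in> center_cent" using assms commutator_in_center_cent by simp
  then have "x \<otimes> commutator G g w = commutator G g w \<otimes> x"
    using assms center_centD by auto
  then have "x \<otimes> commutator G g w \<otimes> inv x = commutator G g w"
    using c assms commute_conj by simp
  then show ?thesis using commutator_mult_right[of g x w] c assms by simp
qed

lemma center_cent_pow: "x \<in> center_cent \<Longrightarrow> x [^] (k::nat) \<in> center_cent"
  using center_le_center_cent one_in_center center_cent_mult by (induction k) auto

lemma commutator_center_cent_pow_right:
  assumes "x \<in> center_cent" "g \<in> carrier G"
  shows "commutator G g (x [^] (k::nat)) = commutator G g x [^] k"
proof (induction k)
  case 0
  then show ?case using assms by (simp add: commutator_def)
next
  case (Suc k)
  then show ?case
    using assms commutator_center_cent_mult_right[OF center_cent_pow] by simp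
qed

text \<open>Each further factor y contributes [y^k, [y, x]] = [y, [y, x]]^k, and these exponents add
  up to a binomial coefficient. The formula serves to compare [y^m, x] with [y, x]^m.\<close>

lemma commutator_pow_left:
  assumes x: "x \<in> center_cent" and y: "y \<in> carrier G"
  shows "commutator G (y [^] (k::nat)) x
    = commutator G y (commutator G y x) [^] (k choose 2) \<otimes> commutator G y x [^] k"
proof (induction k)
  case 0
  then show ?case using center_centD(2)[OF x] y by (simp add: commutator_def binomial_eq_0)
next
  case (Suc k)
  let ?c = "commutator G y x" and ?e = "commutator G y (commutator G y x)"
  have xc: "x \<in> carrier G" using x center_centD by auto
  have c2: "?c \<in> second_center" using commutators_in_second_center xc y by simp
  have "commutator G (y [^] Suc k) x
      = commutator G (y [^] k) ?c \<otimes> ?c \<otimes> commutator G (y [^] k) x"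
    using commutator_mult_left[of "y [^] k" y x] xc y by simp
  also have "commutator G (y [^] k) ?c = ?e [^] k"
    using commutator_second_center_pow_left[OF y c2] by simp
  also have "?e [^] k \<otimes> ?c \<otimes> commutator G (y [^] k) x
      = ?e [^] k \<otimes> (?c \<otimes> ?e [^] (k choose 2)) \<otimes> ?c [^] k"
    unfolding Suc using xc y by (simp add: m_assoc)
  \<comment> \<open>The double commutator is central, so its powers can be collected in
    front.\<close>
  also have "?c \<otimes> ?e [^] (k choose 2) = ?e [^] (k choose 2) \<otimes> ?c"
  proof -
    have "?e \<in> center" using second_centerD(2)[OF c2 y] .
    then have "?e \<otimes> ?c = ?c \<otimes> ?e" by (rule centerD(2)) (use xc y in auto)
    then have "?e [^] (k choose 2) \<otimes> ?c = ?c \<otimes> ?e [^] (k choose 2)"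
      by (rule group_commutes_pow) (use xc y in auto)
    then show ?thesis by simp
  qed
  also have "?e [^] k \<otimes> (?e [^] (k choose 2) \<otimes> ?c) \<otimes> ?c [^] k
      = ?e [^] (k + (k choose 2)) \<otimes> ?c [^] Suc k"
  proof -
    have "?e [^] k \<otimes> (?e [^] (k choose 2) \<otimes> ?c) \<otimes> ?c [^] k
        = (?e [^] k \<otimes> ?e [^] (k choose 2)) \<otimes> (?c \<otimes> ?c [^] k)"
      using xc y by (simp add: m_assoc)
    also have "?c \<otimes> ?c [^] k = ?c [^] Suc k"
      by (rule nat_pow_Suc2[symmetric]) (use xc y in auto)
    also have "?e [^] k \<otimes> ?e [^] (k choose 2) = ?e [^] (k + (k choose 2))"
      by (rule nat_pow_mult) (use xc y in auto)
    finally show ?thesis .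
  qed
  also have "k + (k choose 2) = Suc k choose 2"
    by (simp add: numeral_2_eq_2)
  finally show ?case .
qed

text \<open>Suppose that c^m = [y, x^m] is central, where c = [y, x]. Then [g, c]^m = 1 for every g,
  and by the symmetry of double commutators also [g, [y^m, x]] = 1. So [y^m, x] is central, hence
  trivial, and \<open>commutator_pow_left\<close> gives back c^m = 1.\<close>

lemma good_pow:
  assumes x: "good x" and m: "odd m"
  shows "good (x [^] (m::nat))"
proof -
  have xd: "x \<in> center_cent" and xc: "x \<in> carrier G"
    using x good_in_center_cent by (auto simp: good_def)
  have "commutator G y (x [^] m) = \<one>"
    if y: "y \<in> carrier G" and z: "commutator G y (x [^] m) \<in> center" for y
  proof -
    let ?c = "commutator G y x"
    have c2: "?c \<in> second_center" using commutators_in_second_center y xc by simp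
    have eq: "commutator G y (x [^] m) = ?c [^] m"
      using commutator_center_cent_pow_right[OF xd y] .
    have 1: "commutator G g ?c [^] m = \<one>" if g: "g \<in> carrier G" for g
    proof -
      have "commutator G g (?c [^] m) = \<one>"
        using z g commutator_eq_one_iff centerD unfolding eq by simp
      then show ?thesis using commutator_second_center_pow_right[OF g c2] by simp
    qed
    have "commutator G g (commutator G (y [^] m) x) = \<one>" if g: "g \<in> carrier G" for g
    proof -
      have g2: "commutator G g x \<in> second_center" using commutators_in_second_center g xc by simp
      have "commutator G g (commutator G (y [^] m) x) = commutator G (y [^] m) (commutator G g x)"
        using commutator_commutator_sym[OF xd g] y by simp
      also have "\<dots> = commutator G y (commutator G g x) [^] m"
        using commutator_second_center_pow_left[OF y g2] .
      also have "\<dots> = \<one>" using commutator_commutator_sym[OF xd g y] 1[OF g] by simp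
      finally show ?thesis .
    qed
    then have "commutator G (y [^] m) x \<in> center"
      using y xc commutator_eq_one_iff by (auto simp: center_def)
    then have "commutator G (y [^] m) x = \<one>"
      using x y by (simp add: good_def)
    \<comment> \<open>Oddness enters here: m divides m choose 2, so the correction term
      vanishes.\<close>
    moreover have "commutator G y ?c [^] (m choose 2) = \<one>"
    proof -
      have "m choose 2 = m * ((m - 1) div 2)"
        using m by (simp add: choose_two div_mult_swap)
      then show ?thesis
        using 1[OF y] y xc by (metis commutator_closed nat_pow_one nat_pow_pow)
    qed
    ultimately have "?c [^] m = \<one>"
      using commutator_pow_left[OF xd y, of m] y xc by simp
    then show ?thesis using eq by simp
  qed
  then show ?thesis using xc by (simp add: good_def)
qed

text \<open>Conjugating [y, g x g^-1] by g^-1 gives a commutator with x, and does not change it when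
  it is central.\<close>

lemma good_conj:
  assumes x: "good x" and g: "g \<in> carrier G"
  shows "good (g \<otimes> x \<otimes> inv g)"
proof -
  have xc: "x \<in> carrier G" using x by (simp add: good_def)
  have "commutator G y (g \<otimes> x \<otimes> inv g) = \<one>"
    if y: "y \<in> carrier G" and z: "commutator G y (g \<otimes> x \<otimes> inv g) \<in> center" for y
  proof -
    let ?y = "inv g \<otimes> y \<otimes> g"
    have eq: "commutator G ?y x = inv g \<otimes> commutator G y (g \<otimes> x \<otimes> inv g) \<otimes> inv (inv g)"
      using y g xc by (simp add: free_group_simps)
    then have "commutator G ?y x = commutator G y (g \<otimes> x \<otimes> inv g)"
      using conj_center[OF z, of "inv g"] g by simp
    moreover have "commutator G ?y x = \<one>"
      using x calculation z y g unfolding good_def by (metis inv_closed m_closed)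
    ultimately show ?thesis by simp
  qed
  then show ?thesis using xc g by (simp add: good_def)
qed

end

section \<open>Gauss sums on finite groups\<close>

lemma root_of_unity_one: "root_of_unity 1"
  unfolding root_of_unity_def by (intro exI[of _ 1]) simp

lemma root_of_unity_mult:
  assumes "root_of_unity a" "root_of_unity b"
  shows "root_of_unity (a * b)"
proof -
  from assms obtain m n :: nat where mn: "m > 0" "a ^ m = 1" "n > 0" "b ^ n = 1"
    by (auto simp: root_of_unity_def)
  have "(a * b) ^ (m * n) = (a ^ m) ^ n * (b ^ n) ^ m"
    by (simp add: power_mult_distrib mult.commute flip: power_mult)
  then show ?thesis
    using mn unfolding root_of_unity_def by (intro exI[of _ "m * n"]) simp
qed

lemma root_of_unity_power: "root_of_unity a \<Longrightarrow> root_of_unity (a ^ k)"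
  by (induction k) (auto intro: root_of_unity_one root_of_unity_mult)

lemma root_of_unity_if_power:
  assumes "root_of_unity (a ^ k)" "k > 0"
  shows "root_of_unity a"
proof -
  from assms obtain n where "n > 0" "a ^ (k * n) = 1"
    by (auto simp: root_of_unity_def power_mult)
  then show ?thesis
    using assms(2) unfolding root_of_unity_def by (intro exI[of _ "k * n"]) simp
qed

lemma root_of_unity_norm: "root_of_unity a \<Longrightarrow> norm a = 1"
  unfolding root_of_unity_def using power_eq_1_iff by blast

lemma root_of_unity_nonzero: "root_of_unity a \<Longrightarrow> a \<noteq> 0"
  by (auto dest: root_of_unity_norm)

lemma root_of_unity_cnj:
  assumes "root_of_unity a"
  shows "cnj a = inverse a"
proof -
  have "a * cnj a = 1"
    using root_of_unity_norm[OF assms] complex_norm_square[of a] by simp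
  then show ?thesis
    using inverse_unique by metis
qed

text \<open>Zero counts as having such a phase, so vanishing sums need no exception when products
  are formed.\<close>

definition root_of_unity_phase :: "complex \<Rightarrow> bool" where
  "root_of_unity_phase z \<longleftrightarrow> (\<exists>w. root_of_unity w \<and> z = complex_of_real (norm z) * w)"

lemma root_of_unity_phaseI:
  assumes "root_of_unity w" "z = complex_of_real r * w" "r \<ge> 0"
  shows "root_of_unity_phase z"
  using assms root_of_unity_norm[of w] unfolding root_of_unity_phase_def
  by (intro exI[of _ w]) (simp add: norm_mult)

lemma root_of_unity_phase_mult:
  assumes "root_of_unity_phase y" "root_of_unity_phase z"
  shows "root_of_unity_phase (y * z)"
proof -
  from assms obtain v w where v: "root_of_unity v" "y = complex_of_real (norm y) * v"
    and w: "root_of_unity w" "z = complex_of_real (norm z) * w"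
    by (auto simp: root_of_unity_phase_def)
  have "y * z = (complex_of_real (norm y) * v) * (complex_of_real (norm z) * w)"
    using v(2) w(2) by (rule arg_cong2[where f = "(*)"])
  then show ?thesis
    using v(1) w(1) by (intro root_of_unity_phaseI[of "v * w" _ "norm y * norm z"])
      (auto intro: root_of_unity_mult)
qed

lemma root_of_unity_phase_root: "root_of_unity w \<Longrightarrow> root_of_unity_phase w"
  by (rule root_of_unity_phaseI[of w _ 1]) auto

lemma root_of_unity_phase_nonneg: "r \<ge> 0 \<Longrightarrow> root_of_unity_phase (complex_of_real r)"
  by (rule root_of_unity_phaseI[of 1 _ r]) (auto simp: root_of_unity_one)

text \<open>A k-th root of a root of unity is again one. Hence the phase of a Gauss sum can be
  tested on its square.\<close>

lemma root_of_unity_phase_if_power: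
  assumes "root_of_unity_phase (z ^ k)" "k > 0"
  shows "root_of_unity_phase z"
proof (cases "z = 0")
  case True
  then show ?thesis using root_of_unity_phase_nonneg[of 0] by simp
next
  case False
  define w where "w = z / complex_of_real (norm z)"
  from assms(1) obtain v where v: "root_of_unity v" "z ^ k = complex_of_real (norm (z ^ k)) * v"
    by (auto simp: root_of_unity_phase_def)
  have "w ^ k = z ^ k / complex_of_real (norm z) ^ k" by (simp add: w_def power_divide)
  also have "\<dots> = v" using False by (subst v(2)) (simp add: norm_power)
  finally have "root_of_unity (w ^ k)" using v by simp
  then have "root_of_unity w" using assms(2) root_of_unity_if_power by blast
  then show ?thesis
    using False by (intro root_of_unity_phaseI[of w _ "norm z"]) (auto simp: w_def)
qed

text \<open>The square of z equals its own conjugate, so it is real and a nonnegative multiple of 1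
  or -1.\<close>

lemma root_of_unity_phase_if_square_self_conj:
  assumes "z\<^sup>2 = (cnj z)\<^sup>2"
  shows "root_of_unity_phase z"
proof -
  have "cnj (z\<^sup>2) = z\<^sup>2" using assms by simp
  then have "z\<^sup>2 \<in> \<real>" by (simp add: Reals_cnj_iff)
  then obtain r where r: "z\<^sup>2 = complex_of_real r" by (auto elim: Reals_cases)
  have "root_of_unity (- 1)" unfolding root_of_unity_def by (intro exI[of _ 2]) simp
  then have "root_of_unity_phase (z\<^sup>2)"
    unfolding r by (cases "r \<ge> 0")
      (auto intro: root_of_unity_phase_nonneg root_of_unity_phaseI[of "-1" _ "- r"])
  then show ?thesis by (rule root_of_unity_phase_if_power) simp
qed

section \<open>Linear characters and symmetric bicharacters\<close>

locale finite_group = group +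
  assumes finite_carrier: "finite (carrier G)"
begin

definition linear_char :: "('a \<Rightarrow> complex) \<Rightarrow> bool" where
  "linear_char c \<longleftrightarrow> (\<forall>g\<in>carrier G. c g \<noteq> 0) \<and>
     (\<forall>g\<in>carrier G. \<forall>h\<in>carrier G. c (g \<otimes> h) = c g * c h)"

definition sym_bichar :: "('a \<Rightarrow> 'a \<Rightarrow> complex) \<Rightarrow> bool" where
  "sym_bichar B \<longleftrightarrow> (\<forall>h\<in>carrier G. linear_char (\<lambda>g. B g h)) \<and>
     (\<forall>g\<in>carrier G. \<forall>h\<in>carrier G. B g h = B h g)"

definition radical :: "('a \<Rightarrow> 'a \<Rightarrow> complex) \<Rightarrow> 'a set" where
  "radical B = {h \<in> carrier G. \<forall>g\<in>carrier G. B g h = 1}"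

text \<open>No condition f(g^-1) = f(g) is imposed: f may be multiplied by any
  \<open>linear_char\<close> without changing B. This leaves room for the linear part of g |->
  \<mu>([g, x]).\<close>

definition quadratic :: "('a \<Rightarrow> complex) \<Rightarrow> ('a \<Rightarrow> 'a \<Rightarrow> complex) \<Rightarrow> bool" where
  "quadratic f B \<longleftrightarrow> sym_bichar B \<and> (\<forall>g\<in>carrier G. root_of_unity (f g)) \<and>
     (\<forall>g\<in>carrier G. \<forall>h\<in>carrier G. f (g \<otimes> h) = f g * f h * B g h)"

lemma card_carrier_pos: "card (carrier G) > 0"
  using finite_carrier one_closed card_gt_0_iff by blast

lemma sum_translate:
  assumes "h \<in> carrier G"
  shows "(\<Sum>g\<in>carrier G. F (g \<otimes> h)) = (\<Sum>g\<in>carrier G. F g :: complex)"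
    and "(\<Sum>g\<in>carrier G. F (h \<otimes> g)) = (\<Sum>g\<in>carrier G. F g :: complex)"
proof -
  have "bij_betw (\<lambda>g. g \<otimes> h) (carrier G) (carrier G)"
    by (rule bij_betw_byWitness[where f' = "\<lambda>g. g \<otimes> inv h"]) (use assms in \<open>auto simp: m_assoc\<close>)
  then show "(\<Sum>g\<in>carrier G. F (g \<otimes> h)) = (\<Sum>g\<in>carrier G. F g)"
    by (rule sum.reindex_bij_betw)
  have "bij_betw (\<lambda>g. h \<otimes> g) (carrier G) (carrier G)"
    by (rule bij_betw_byWitness[where f' = "\<lambda>g. inv h \<otimes> g"]) (use assms in auto)
  then show "(\<Sum>g\<in>carrier G. F (h \<otimes> g)) = (\<Sum>g\<in>carrier G. F g)"
    by (rule sum.reindex_bij_betw)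
qed

lemma linear_charD:
  "linear_char c \<Longrightarrow> g \<in> carrier G \<Longrightarrow> c g \<noteq> 0"
  "linear_char c \<Longrightarrow> g \<in> carrier G \<Longrightarrow> h \<in> carrier G \<Longrightarrow> c (g \<otimes> h) = c g * c h"
  by (auto simp: linear_char_def)

lemma linear_char_one: "linear_char c \<Longrightarrow> c \<one> = 1"
  using linear_charD[of c \<one>] by fastforce

lemma linear_char_pow:
  "linear_char c \<Longrightarrow> g \<in> carrier G \<Longrightarrow> c (g [^] (k::nat)) = c g ^ k"
  by (induction k) (simp_all add: linear_char_one linear_charD)

lemma linear_char_power_card:
  "linear_char c \<Longrightarrow> g \<in> carrier G \<Longrightarrow> c g ^ card (carrier G) = 1"
  using linear_char_pow[of c g "card (carrier G)"] pow_order_eq_1[of g] linear_char_one[of c]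
  by (simp add: Coset.order_def)

text \<open>Translating by an h with \<open>c h\<close> different from 1 multiplies the sum by
  \<open>c h\<close>, which forces it to be 0.\<close>

lemma sum_linear_char:
  assumes c: "linear_char c"
  shows "(\<Sum>g\<in>carrier G. c g) = (if \<forall>g\<in>carrier G. c g = 1 then of_nat (card (carrier G)) else 0)"
proof (cases "\<forall>g\<in>carrier G. c g = 1")
  case False
  then obtain h where h: "h \<in> carrier G" "c h \<noteq> 1" by auto
  have "(\<Sum>g\<in>carrier G. c g) = (\<Sum>g\<in>carrier G. c (g \<otimes> h))"
    using sum_translate(1)[OF h(1)] by simp
  also have "\<dots> = (\<Sum>g\<in>carrier G. c g) * c h"
    using h c by (simp add: linear_charD sum_distrib_right)
  finally show ?thesis using h by auto
qed auto

lemma linear_char_mult: "linear_char c \<Longrightarrow> linear_char d \<Longrightarrow> linear_char (\<lambda>g. c g * d g)"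
  by (simp add: linear_char_def)

lemma linear_char_inverse: "linear_char c \<Longrightarrow> linear_char (\<lambda>g. inverse (c g))"
  by (simp add: linear_char_def)

lemma linear_char_power: "linear_char c \<Longrightarrow> linear_char (\<lambda>g. c g ^ k)"
  by (simp add: linear_char_def power_mult_distrib)

lemma sym_bicharD:
  assumes "sym_bichar B"
  shows "g \<in> carrier G \<Longrightarrow> h \<in> carrier G \<Longrightarrow> B g h = B h g"
    and "h \<in> carrier G \<Longrightarrow> linear_char (\<lambda>g. B g h)"
    and "h \<in> carrier G \<Longrightarrow> linear_char (B h)"
proof -
  show *: "B g h = B h g" if "g \<in> carrier G" "h \<in> carrier G" for g h
    using assms that by (simp add: sym_bichar_def)
  show **: "linear_char (\<lambda>g. B g h)" if "h \<in> carrier G" for h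
    using assms that by (simp add: sym_bichar_def)
  show "linear_char (B h)" if h: "h \<in> carrier G" for h
    using **[OF h] *[OF h] unfolding linear_char_def by simp
qed

lemma sym_bichar_mult:
  assumes "sym_bichar B" "g \<in> carrier G" "h \<in> carrier G" "k \<in> carrier G"
  shows "B (g \<otimes> h) k = B g k * B h k" "B k (g \<otimes> h) = B k g * B k h"
  using linear_charD(2)[OF sym_bicharD(2)[OF assms(1,4)] assms(2,3)]
    linear_charD(2)[OF sym_bicharD(3)[OF assms(1,4)] assms(2,3)] by simp_all

lemma sym_bichar_pow:
  assumes "sym_bichar B" "g \<in> carrier G" "k \<in> carrier G"
  shows "B (g [^] (n::nat)) k = B g k ^ n" "B k (g [^] (n::nat)) = B k g ^ n"
  using linear_char_pow[OF sym_bicharD(2)[OF assms(1,3)] assms(2)]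
    linear_char_pow[OF sym_bicharD(3)[OF assms(1,3)] assms(2)] by simp_all

lemma sym_bichar_nonzero:
  "sym_bichar B \<Longrightarrow> g \<in> carrier G \<Longrightarrow> h \<in> carrier G \<Longrightarrow> B g h \<noteq> 0"
  using linear_charD(1)[OF sym_bicharD(3)] by blast

lemma sym_bichar_power_card:
  "sym_bichar B \<Longrightarrow> g \<in> carrier G \<Longrightarrow> h \<in> carrier G \<Longrightarrow> B g h ^ card (carrier G) = 1"
  using linear_char_power_card[OF sym_bicharD(3)] by blast

lemma sym_bichar_root_of_unity:
  "sym_bichar B \<Longrightarrow> g \<in> carrier G \<Longrightarrow> h \<in> carrier G \<Longrightarrow> root_of_unity (B g h)"
  unfolding root_of_unity_def using sym_bichar_power_card card_carrier_pos by blast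

lemma sym_bichar_power: "sym_bichar B \<Longrightarrow> sym_bichar (\<lambda>g h. B g h ^ k)"
  by (simp add: sym_bichar_def linear_char_power)

lemma radicalD: "h \<in> radical B \<Longrightarrow> h \<in> carrier G" "h \<in> radical B \<Longrightarrow> g \<in> carrier G \<Longrightarrow> B g h = 1"
  by (auto simp: radical_def)

lemma radicalI: "h \<in> carrier G \<Longrightarrow> (\<And>g. g \<in> carrier G \<Longrightarrow> B g h = 1) \<Longrightarrow> h \<in> radical B"
  by (auto simp: radical_def)

lemma one_in_radical: "sym_bichar B \<Longrightarrow> \<one> \<in> radical B"
  using linear_char_one[OF sym_bicharD(3)] by (auto intro: radicalI)

lemma finite_radical: "finite (radical B)"
  using finite_carrier by (rule finite_subset[rotated]) (auto simp: radical_def)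

text \<open>By \<open>sum_linear_char\<close> the inner sum is |G| on the radical and 0 off
  it.\<close>

lemma sum_radical:
  assumes B: "sym_bichar B"
  shows "(\<Sum>h\<in>carrier G. F h * (\<Sum>g\<in>carrier G. B g h)) = of_nat (card (carrier G)) * (\<Sum>h\<in>radical B. F h)"
proof -
  have "(\<Sum>h\<in>carrier G. F h * (\<Sum>g\<in>carrier G. B g h))
      = (\<Sum>h\<in>carrier G. if h \<in> radical B then F h * of_nat (card (carrier G)) else 0)"
    using sum_linear_char[OF sym_bicharD(2)[OF B]] by (intro sum.cong) (auto simp: radical_def)
  also have "\<dots> = (\<Sum>h\<in>radical B. F h * of_nat (card (carrier G)))"
    using finite_carrier by (subst sum.inter_restrict[symmetric]) (auto intro: sum.cong simp: radical_def)
  finally show ?thesis by (simp add: sum_distrib_left mult.commute)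
qed

text \<open>An averaging argument takes the place of duality: c(g) / B(g, t), summed over all g and
  t, gives |G| times the size of the radical. So for some t the sum over g is nonzero, and then the
  linear character c / B(., t) is trivial.\<close>

lemma linear_char_represented:
  assumes B: "sym_bichar B" and c: "linear_char c" and rad: "\<And>r. r \<in> radical B \<Longrightarrow> c r = 1"
  obtains t where "t \<in> carrier G" "\<And>g. g \<in> carrier G \<Longrightarrow> c g = B g t"
proof -
  define B' where "B' = (\<lambda>g h. inverse (B g h))"
  have B': "sym_bichar B'"
    using B by (simp add: B'_def sym_bichar_def linear_char_inverse)
  have rad': "radical B' = radical B" by (auto simp: radical_def B'_def)
  have "(\<Sum>t\<in>carrier G. \<Sum>g\<in>carrier G. c g * B' g t)
      = (\<Sum>g\<in>carrier G. c g * (\<Sum>t\<in>carrier G. B' t g))"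
    using sym_bicharD(1)[OF B'] by (subst sum.swap) (simp add: sum_distrib_left)
  also have "\<dots> = of_nat (card (carrier G)) * of_nat (card (radical B))"
    unfolding sum_radical[OF B'] rad' using rad by simp
  finally have "(\<Sum>t\<in>carrier G. \<Sum>g\<in>carrier G. c g * B' g t) \<noteq> 0"
    using card_carrier_pos finite_carrier finite_radical one_in_radical[OF B]
    by (auto simp: card_eq_0_iff)
  then obtain t where t: "t \<in> carrier G" "(\<Sum>g\<in>carrier G. c g * B' g t) \<noteq> 0"
    by (meson sum.neutral)
  have "\<forall>g\<in>carrier G. c g * B' g t = 1"
    using t sum_linear_char[OF linear_char_mult[OF c sym_bicharD(2)[OF B' t(1)]]]
    by (auto split: if_splits)
  then have "c g = B g t" if "g \<in> carrier G" for g
    using that sym_bichar_nonzero[OF B that t(1)] by (auto simp: B'_def field_simps)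
  then show ?thesis using t that by blast
qed

section \<open>Quadratic functions and their Gauss sums\<close>

lemma quadraticD:
  assumes "quadratic f B"
  shows "sym_bichar B" "g \<in> carrier G \<Longrightarrow> root_of_unity (f g)"
    "g \<in> carrier G \<Longrightarrow> f g \<noteq> 0"
    "g \<in> carrier G \<Longrightarrow> h \<in> carrier G \<Longrightarrow> f (g \<otimes> h) = f g * f h * B g h"
  using assms root_of_unity_nonzero by (auto simp: quadratic_def)

text \<open>Substituting g d for g in the sum of f produces the factor f(d) B(g, d).\<close>

lemma quadratic_translate:
  assumes f: "quadratic f B" and d: "d \<in> carrier G"
  shows "(\<Sum>g\<in>carrier G. f g * B g d) = (\<Sum>g\<in>carrier G. f g) / f d"
proof -
  have "(\<Sum>g\<in>carrier G. f g) = (\<Sum>g\<in>carrier G. f (g \<otimes> d))"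
    using sum_translate(1)[OF d] by simp
  also have "\<dots> = (\<Sum>g\<in>carrier G. f g * B g d) * f d"
    unfolding sum_distrib_right using d quadraticD(4)[OF f] by (intro sum.cong refl) simp
  finally show ?thesis using quadraticD(3)[OF f d] by (simp add: field_simps)
qed

text \<open>Twisting by B(., r) leaves the sum alone, yet divides it by f(r).\<close>

lemma quadratic_radical:
  assumes f: "quadratic f B" and nz: "(\<Sum>g\<in>carrier G. f g) \<noteq> 0" and r: "r \<in> radical B"
  shows "f r = 1"
proof -
  have "(\<Sum>g\<in>carrier G. f g * B g r) = (\<Sum>g\<in>carrier G. f g)"
    using radicalD(2)[OF r] by simp
  then show ?thesis
    using quadratic_translate[OF f radicalD(1)[OF r]] nz quadraticD(3)[OF f radicalD(1)[OF r]]
    by (auto simp: divide_eq_eq)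
qed

text \<open>In the product of the sum with its conjugate, write the second variable as g h. The
  double sum becomes that of f(h) B(g, h), and summing over g first restricts h to the
  radical.\<close>

lemma norm_quadratic_sum:
  assumes f: "quadratic f B" and rad: "\<And>r. r \<in> radical B \<Longrightarrow> f r = 1"
  shows "(norm (\<Sum>g\<in>carrier G. f g))\<^sup>2 = real (card (carrier G)) * real (card (radical B))"
proof -
  let ?S = "\<Sum>g\<in>carrier G. f g"
  have cnj: "cnj ?S = (\<Sum>g\<in>carrier G. inverse (f g))"
    using quadraticD(2)[OF f] root_of_unity_cnj by simp
  have "?S * cnj ?S = (\<Sum>g\<in>carrier G. inverse (f g) * (\<Sum>h\<in>carrier G. f (g \<otimes> h)))"
    unfolding cnj
    by (subst sum_distrib_left) (intro sum.cong refl, simp add: sum_translate(2) mult.commute)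
  also have "\<dots> = (\<Sum>g\<in>carrier G. \<Sum>h\<in>carrier G. f h * B g h)"
    using quadraticD(3,4)[OF f] by (intro sum.cong refl) (simp add: sum_distrib_left field_simps)
  also have "\<dots> = (\<Sum>h\<in>carrier G. f h * (\<Sum>g\<in>carrier G. B g h))"
    by (subst sum.swap) (simp add: sum_distrib_left)
  also have "\<dots> = of_nat (card (carrier G)) * of_nat (card (radical B))"
    unfolding sum_radical[OF quadraticD(1)[OF f]] using rad by simp
  finally have "complex_of_real ((norm ?S)\<^sup>2)
      = complex_of_real (real (card (carrier G)) * real (card (radical B)))"
    unfolding complex_norm_square by simp
  then show ?thesis using of_real_eq_iff by blast
qed

text \<open>The square of the sum is a sum of Gauss sums for the squared form. Averaging over
  translations by squares turns all nonzero terms of it into the same product, to which the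
  induction hypothesis applies.\<close>

lemma quadratic_sum_phase_two_power:
  assumes "quadratic f B" "\<And>g h. g \<in> carrier G \<Longrightarrow> h \<in> carrier G \<Longrightarrow> B g h ^ (2 ^ k) = 1"
  shows "root_of_unity_phase (\<Sum>g\<in>carrier G. f g)"
  using assms
proof (induction k arbitrary: f B)
  case 0
  \<comment> \<open>For k = 0 the form is identically 1, so f is multiplicative.\<close>
  then have "linear_char f"
    using quadraticD(3,4)[OF 0(1)] by (simp add: linear_char_def)
  then show ?case
    using sum_linear_char[of f] root_of_unity_phase_nonneg[of "real (card (carrier G))"]
      root_of_unity_phase_nonneg[of 0] by simp
next
  case (Suc k)
  note f = Suc.prems(1)
  note B = quadraticD(1)[OF f]
  let ?S = "\<Sum>g\<in>carrier G. f g"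
  let ?N = "of_nat (card (carrier G)) :: complex"
  show ?case
  proof (cases "?S = 0")
    case True
    then show ?thesis using root_of_unity_phase_nonneg[of 0] by simp
  next
    case False
    note f_rad = quadratic_radical[OF f False]
    \<comment> \<open>Squaring the form lowers the exponent from k + 1 to k.\<close>
    define C where "C = (\<lambda>g h. (B g h)\<^sup>2)"
    have C: "sym_bichar C" unfolding C_def by (rule sym_bichar_power[OF B])
    have C_pow: "C g h ^ (2 ^ k) = 1" if "g \<in> carrier G" "h \<in> carrier G" for g h
      using Suc.prems(2)[OF that] by (simp add: C_def power_mult)
    \<comment> \<open>Since f(g) f(g h) = f(h) F_h(g), the square of the sum becomes a combination
      of Gauss sums for C.\<close>
    define F where "F = (\<lambda>h g. (f g)\<^sup>2 * B g h)"
    \<comment> \<open>This is the factor by which the term of h changes under translation by the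
      square of e, see \<open>\<phi>_shift\<close>.\<close>
    define q where "q = (\<lambda>h e. B e e * B e h)"
    have F: "quadratic (F h) C" if h: "h \<in> carrier G" for h
      unfolding quadratic_def using C h quadraticD(2,4)[OF f] sym_bichar_mult[OF B]
      by (auto simp: F_def C_def power_mult_distrib
          intro!: root_of_unity_mult root_of_unity_power sym_bichar_root_of_unity[OF B])
    have q: "quadratic (q h) C" if h: "h \<in> carrier G" for h
      unfolding quadratic_def using C h sym_bichar_mult[OF B] sym_bicharD(1)[OF B]
      by (auto simp: q_def C_def power2_eq_square
          intro!: root_of_unity_mult sym_bichar_root_of_unity[OF B])
    define SF where "SF = (\<lambda>h. \<Sum>g\<in>carrier G. F h g)"
    define Sq where "Sq = (\<lambda>h. \<Sum>e\<in>carrier G. q h e)"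
    define \<phi> where "\<phi> = (\<lambda>h. f h * SF h)"
    have square: "?S\<^sup>2 = (\<Sum>h\<in>carrier G. \<phi> h)"
    proof -
      have "?S\<^sup>2 = (\<Sum>g\<in>carrier G. f g * (\<Sum>h\<in>carrier G. f (g \<otimes> h)))"
        by (simp add: power2_eq_square sum_distrib_right sum_translate(2))
      also have "\<dots> = (\<Sum>g\<in>carrier G. \<Sum>h\<in>carrier G. f h * F h g)"
        using quadraticD(4)[OF f]
        by (intro sum.cong refl) (simp add: sum_distrib_left F_def power2_eq_square mult_ac)
      also have "\<dots> = (\<Sum>h\<in>carrier G. \<phi> h)"
        by (subst sum.swap) (simp add: sum_distrib_left \<phi>_def SF_def)
      finally show ?thesis .
    qed
    have SF_shift: "SF (h \<otimes> (d \<otimes> d)) = SF h / F h d"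
      and Sq_shift: "Sq (h \<otimes> (d \<otimes> d)) = Sq h / q h d"
      if h: "h \<in> carrier G" and d: "d \<in> carrier G" for h d
    proof -
      have "SF (h \<otimes> (d \<otimes> d)) = (\<Sum>g\<in>carrier G. F h g * C g d)"
        unfolding SF_def using sym_bichar_mult[OF B] h d
        by (intro sum.cong refl) (simp add: F_def C_def power2_eq_square)
      then show "SF (h \<otimes> (d \<otimes> d)) = SF h / F h d"
        using quadratic_translate[OF F[OF h] d] by (simp add: SF_def)
      have "Sq (h \<otimes> (d \<otimes> d)) = (\<Sum>g\<in>carrier G. q h g * C g d)"
        unfolding Sq_def using sym_bichar_mult[OF B] h d
        by (intro sum.cong refl) (simp add: q_def C_def power2_eq_square)
      then show "Sq (h \<otimes> (d \<otimes> d)) = Sq h / q h d"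
        using quadratic_translate[OF q[OF h] d] by (simp add: Sq_def)
    qed
    have \<phi>_shift: "\<phi> (h \<otimes> (d \<otimes> d)) = \<phi> h * q h d"
      if h: "h \<in> carrier G" and d: "d \<in> carrier G" for h d
    proof -
      have "f (h \<otimes> (d \<otimes> d)) = f h * (f d)\<^sup>2 * B d d * (B d h)\<^sup>2"
        using h d quadraticD(4)[OF f] sym_bichar_mult[OF B] sym_bicharD(1)[OF B h d]
        by (simp add: power2_eq_square)
      then show ?thesis
        unfolding \<phi>_def SF_shift[OF h d]
        using quadraticD(3)[OF f d] sym_bichar_nonzero[OF B d h]
        by (simp add: F_def q_def power2_eq_square)
    qed
    \<comment> \<open>Averaging over translations by d^2 replaces the term \<phi>(h) by \<phi>(h)
      times the sum of q_h. This product is invariant under translation by squares: the first factor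
      is multiplied by q_h(d) and the second divided by it.\<close>
    define \<psi> where "\<psi> = (\<lambda>h. \<phi> h * Sq h)"
    have \<psi>_shift: "\<psi> (h \<otimes> (d \<otimes> d)) = \<psi> h" if h: "h \<in> carrier G" and d: "d \<in> carrier G" for h d
      using \<phi>_shift[OF h d] Sq_shift[OF h d] quadraticD(3)[OF q[OF h] d] by (simp add: \<psi>_def)
    have \<psi>_rad: "\<psi> (h \<otimes> r) = \<psi> h" if h: "h \<in> carrier G" and r: "r \<in> radical B" for h r
    proof -
      have B1: "B g (h \<otimes> r) = B g h" if "g \<in> carrier G" for g
        using that h r radicalD[OF r] sym_bichar_mult(2)[OF B h radicalD(1)[OF r] that] by simp
      have "f (h \<otimes> r) = f h"
        using quadraticD(4)[OF f h radicalD(1)[OF r]] radicalD(2)[OF r h] f_rad[OF r] by simp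
      then show ?thesis
        using B1 by (simp add: \<psi>_def \<phi>_def SF_def Sq_def F_def q_def)
    qed
    have "?N * ?S\<^sup>2 = (\<Sum>d\<in>carrier G. \<Sum>h\<in>carrier G. \<phi> (h \<otimes> (d \<otimes> d)))"
      by (simp add: square sum_translate(1))
    also have "\<dots> = (\<Sum>d\<in>carrier G. \<Sum>h\<in>carrier G. \<phi> h * q h d)"
      using \<phi>_shift by simp
    also have "\<dots> = (\<Sum>h\<in>carrier G. \<psi> h)"
      by (subst sum.swap) (simp add: sum_distrib_left \<psi>_def Sq_def)
    finally have eq: "?N * ?S\<^sup>2 = (\<Sum>h\<in>carrier G. \<psi> h)" .
    moreover have "?N * ?S\<^sup>2 \<noteq> 0" using False card_carrier_pos by simp
    ultimately have "(\<Sum>h\<in>carrier G. \<psi> h) \<noteq> 0" by argo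
    then obtain h0 where h0: "h0 \<in> carrier G" "\<psi> h0 \<noteq> 0"
      by (meson sum.neutral)
    \<comment> \<open>Nonzero terms force F_h and F_h0 to be 1 on the radical of C, so for t = h0^-1
      h also B(., t) is 1 there. Hence B(., t) = C(., d) = B(., d^2) for some d, and t is a square
      times an element of the radical of B.\<close>
    have const: "\<psi> h = \<psi> h0" if h: "h \<in> carrier G" and nz: "\<psi> h \<noteq> 0" for h
    proof -
      have nz': "SF h \<noteq> 0" "SF h0 \<noteq> 0" using nz h0 by (auto simp: \<psi>_def \<phi>_def)
      define t where "t = inv h0 \<otimes> h"
      have t: "t \<in> carrier G" and ht: "h = h0 \<otimes> t" using h h0 by (auto simp: t_def)
      have "B u t = 1" if u: "u \<in> radical C" for u
      proof -
        have uc: "u \<in> carrier G" using u radicalD by auto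
        have "F h u = F h0 u"
          using quadratic_radical[OF F[OF h] nz'(1)[unfolded SF_def] u]
            quadratic_radical[OF F[OF h0(1)] nz'(2)[unfolded SF_def] u] by simp
        then show ?thesis
          using quadraticD(3)[OF f uc] sym_bichar_nonzero[OF B uc h0(1)]
            sym_bichar_mult(2)[OF B h0(1) t uc] by (simp add: F_def ht)
      qed
      then obtain d where d: "d \<in> carrier G" "\<And>g. g \<in> carrier G \<Longrightarrow> B g t = C g d"
        using linear_char_represented[OF C sym_bicharD(2)[OF B t]] by blast
      define r where "r = inv (d \<otimes> d) \<otimes> t"
      have rc: "r \<in> carrier G" and tr: "t = (d \<otimes> d) \<otimes> r" using t d by (auto simp: r_def m_assoc)
      have r: "r \<in> radical B"
      proof (rule radicalI[OF rc])
        fix g assume g: "g \<in> carrier G"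
        have "B g t = C g d * B g r"
          unfolding tr using sym_bichar_mult(2)[OF B _ _ g] d(1) rc g
          by (simp add: C_def power2_eq_square)
        then show "B g r = 1" using d(2)[OF g] sym_bichar_nonzero[OF C g d(1)] by simp
      qed
      have "h = (h0 \<otimes> (d \<otimes> d)) \<otimes> r" using h0 d rc by (simp add: ht tr m_assoc)
      then show ?thesis using \<psi>_rad[OF _ r] \<psi>_shift h0(1) d(1) by simp
    qed
    have "(\<Sum>h\<in>carrier G. \<psi> h) = (\<Sum>h\<in>{h \<in> carrier G. \<psi> h \<noteq> 0}. \<psi> h)"
      using finite_carrier by (intro sum.mono_neutral_right) auto
    also have "\<dots> = of_nat (card {h \<in> carrier G. \<psi> h \<noteq> 0}) * \<psi> h0"
    proof -
      have "(\<Sum>h\<in>{h \<in> carrier G. \<psi> h \<noteq> 0}. \<psi> h) = (\<Sum>h\<in>{h \<in> carrier G. \<psi> h \<noteq> 0}. \<psi> h0)"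
        by (intro sum.cong refl) (auto intro: const)
      then show ?thesis by simp
    qed
    finally have "?N * ?S\<^sup>2 = of_nat (card {h \<in> carrier G. \<psi> h \<noteq> 0}) * \<psi> h0"
      using eq by simp
    then have "?S\<^sup>2 = complex_of_real (real (card {h \<in> carrier G. \<psi> h \<noteq> 0}) / real (card (carrier G))) * \<psi> h0"
      using card_carrier_pos by (simp add: field_simps)
    \<comment> \<open>This value is f(h0) times two Gauss sums for C, to which the induction
      hypothesis applies.\<close>
    moreover have "root_of_unity_phase (\<psi> h0)"
      unfolding \<psi>_def \<phi>_def SF_def Sq_def
      using h0(1) quadraticD(2)[OF f] Suc.IH[OF F C_pow] Suc.IH[OF q C_pow]
      by (intro root_of_unity_phase_mult) (auto intro: root_of_unity_phase_root)
    ultimately have "root_of_unity_phase (?S\<^sup>2)"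
      by (auto intro!: root_of_unity_phase_mult root_of_unity_phase_nonneg simp del: of_real_divide)
    then show ?thesis by (rule root_of_unity_phase_if_power) simp
  qed
qed

end

section \<open>Minus one as a sum of two squares modulo odd prime powers\<close>

lemma odd_prime_minus_one_sum_two_squares:
  fixes p :: nat
  assumes p: "prime p" "odd p"
  shows "\<exists>l r::int. int p dvd 1 + l\<^sup>2 + r\<^sup>2 \<and> coprime r (int p)"
proof -
  define m where "m = (p - 1) div 2"
  have pm: "p = 2 * m + 1" using p(2) by (auto simp: m_def elim: oddE)
  have pp: "prime (int p)" using p(1) by simp
  \<comment> \<open>The signs s = 1 and s = -1 serve the two halves of a pigeonhole argument: for 0
    <= l, r <= m the expressions l^2 and -1 - r^2 each take m + 1 values modulo p, and 2 (m + 1) >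
    p.\<close>
  have inj: "inj_on (\<lambda>l::int. (c + s * l\<^sup>2) mod int p) {0..int m}" if s: "s\<^sup>2 = 1" for c s :: int
  proof (rule inj_onI)
    fix x y :: int
    assume x: "x \<in> {0..int m}" and y: "y \<in> {0..int m}"
      and eq: "(c + s * x\<^sup>2) mod int p = (c + s * y\<^sup>2) mod int p"
    have "int p dvd (c + s * x\<^sup>2) - (c + s * y\<^sup>2)" using eq by (simp add: mod_eq_dvd_iff)
    then have "int p dvd s * ((c + s * x\<^sup>2) - (c + s * y\<^sup>2))" by simp
    also have "s * ((c + s * x\<^sup>2) - (c + s * y\<^sup>2)) = s\<^sup>2 * ((x - y) * (x + y))"
      by (simp add: power2_eq_square algebra_simps)
    finally have "int p dvd (x - y) * (x + y)" using s by simp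
    then consider "int p dvd x - y" | "int p dvd x + y" using pp prime_dvd_mult_iff by blast
    then show "x = y"
    proof cases
      case 1
      then show ?thesis using x y pm zdvd_not_zless[of "\<bar>x - y\<bar>" "int p"] by fastforce
    next
      case 2
      then show ?thesis using x y pm zdvd_not_zless[of "x + y" "int p"] by fastforce
    qed
  qed
  let ?f = "\<lambda>l::int. (0 + 1 * l\<^sup>2) mod int p" and ?g = "\<lambda>l::int. (- 1 + (- 1) * l\<^sup>2) mod int p"
  let ?A = "?f ` {0..int m}" and ?B = "?g ` {0..int m}"
  have cA: "card ?A = m + 1" using card_image[OF inj[of 1 0]] by simp
  have cB: "card ?B = m + 1" using card_image[OF inj[of "-1" "-1"]] by simp
  have "?A \<union> ?B \<subseteq> {0..<int p}" using pm by auto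
  then have "card (?A \<union> ?B) \<le> p" using card_mono[of "{0..<int p}" "?A \<union> ?B"] by simp
  then have "?A \<inter> ?B \<noteq> {}"
    using card_Un_disjoint[of ?A ?B] cA cB pm by fastforce
  then obtain l r :: int where "?f l = ?g r" by blast
  then have dvd: "int p dvd 1 + l\<^sup>2 + r\<^sup>2" by (simp add: mod_eq_dvd_iff algebra_simps)
  show ?thesis
  proof (cases "int p dvd r")
    case False
    then have "coprime r (int p)" using prime_imp_coprime[OF pp] coprime_commute by blast
    then show ?thesis using dvd by blast
  next
    \<comment> \<open>If p divides r, it cannot divide l as well, so l and r are exchanged.\<close>
    case True
    have "\<not> int p dvd l"
    proof
      assume "int p dvd l"
      then have "int p dvd l\<^sup>2 + r\<^sup>2" using True by (simp add: power2_eq_square)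
      then have "int p dvd 1" using dvd by (metis add.assoc dvd_add_left_iff)
      then show False using pp by auto
    qed
    then have "coprime l (int p)" using prime_imp_coprime[OF pp] coprime_commute by blast
    moreover have "int p dvd 1 + r\<^sup>2 + l\<^sup>2" using dvd by (simp add: algebra_simps)
    ultimately show ?thesis by blast
  qed
qed

text \<open>Hensel lifting in the second variable: if 1 + l^2 + r^2 = p^(k+1) q, adding p^(k+1) t to
  r changes q into q + 2 r t modulo p. As 2 r is invertible modulo p, some t makes this 0.\<close>

lemma odd_prime_power_minus_one_sum_two_squares:
  fixes p k :: nat
  assumes p: "prime p" "odd p"
  shows "\<exists>l r::int. int p ^ Suc k dvd 1 + l\<^sup>2 + r\<^sup>2 \<and> coprime r (int p)"
proof (induction k)
  case 0
  then show ?case using odd_prime_minus_one_sum_two_squares[OF p] by simp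
next
  case (Suc k)
  then obtain l r q where q: "1 + l\<^sup>2 + r\<^sup>2 = int p ^ Suc k * q" and r: "coprime r (int p)"
    by (auto elim: dvdE)
  have "coprime (2 * r) (int p)" using r p(2) by (simp add: coprime_left_2_iff_odd)
  then obtain u where u: "[(2 * r) * u = 1] (mod int p)"
    using cong_solve_coprime_int by blast
  define t where "t = - q * u"
  have "int p dvd (2 * r) * u - 1" using u by (simp add: cong_iff_dvd_diff)
  then have "int p dvd - q * ((2 * r) * u - 1)" by (rule dvd_mult)
  also have "- q * ((2 * r) * u - 1) = q + 2 * r * t" by (simp add: t_def algebra_simps)
  finally have "int p dvd (q + 2 * r * t) + int p * (int p ^ k * t\<^sup>2)" by (metis dvd_add dvd_triv_left)
  then have "int p ^ Suc k * int p dvd int p ^ Suc k * ((q + 2 * r * t) + int p * (int p ^ k * t\<^sup>2))"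
    by (rule mult_dvd_mono[OF dvd_refl])
  also have "int p ^ Suc k * ((q + 2 * r * t) + int p * (int p ^ k * t\<^sup>2))
      = 1 + l\<^sup>2 + (r + int p ^ Suc k * t)\<^sup>2"
    using q by (simp add: power2_eq_square algebra_simps)
  finally have "int p ^ Suc (Suc k) dvd 1 + l\<^sup>2 + (r + int p ^ Suc k * t)\<^sup>2" by (simp add: mult_ac)
  moreover have "coprime (r + int p ^ Suc k * t) (int p)"
  proof -
    have "gcd (int p) (int p * (int p ^ k * t) + r) = gcd (int p) r" 
      by (metis gcd_add_mult mult.commute add.commute gcd.commute)
    then show ?thesis using r by (simp add: coprime_iff_gcd_eq_1 gcd.commute algebra_simps)
  qed
  ultimately show ?case by blast
qed

text \<open>The three numbers serve as natural exponents of group elements and character values,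
  hence the absolute values. Passing from p^(k+1) to p^k covers k = 0.\<close>

lemma odd_prime_power_minus_one_sum_two_squares_nat:
  fixes p k :: nat
  assumes p: "prime p" "odd p"
  obtains l r a :: nat where "p ^ k dvd 1 + l\<^sup>2 + r\<^sup>2" "[r * a = 1] (mod p ^ k)"
proof -
  from odd_prime_power_minus_one_sum_two_squares[OF p, of k] obtain l r :: int
    where lr: "int p ^ Suc k dvd 1 + l\<^sup>2 + r\<^sup>2" "coprime r (int p)" by blast
  have "int p ^ k dvd 1 + l\<^sup>2 + r\<^sup>2" using lr(1) by (metis dvd_trans le_imp_power_dvd le_SucI order_refl)
  also have "1 + l\<^sup>2 + r\<^sup>2 = int (1 + (nat \<bar>l\<bar>)\<^sup>2 + (nat \<bar>r\<bar>)\<^sup>2)" by simp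
  finally have 1: "p ^ k dvd 1 + (nat \<bar>l\<bar>)\<^sup>2 + (nat \<bar>r\<bar>)\<^sup>2" by (metis of_nat_dvd_iff of_nat_power)
  have "coprime (nat \<bar>r\<bar>) p" using lr(2) by (metis coprime_abs_left_iff coprime_int_iff int_nat_eq abs_ge_zero)
  then have "coprime (nat \<bar>r\<bar>) (p ^ k)" by simp
  then obtain a where "[nat \<bar>r\<bar> * a = 1] (mod p ^ k)" using cong_solve_coprime_nat by (metis One_nat_def)
  then show ?thesis using 1 that by blast
qed

section \<open>Gauss sums on groups of odd prime power order\<close>

context finite_group
begin

lemma power_one_if_card_dvd:
  assumes "z ^ card (carrier G) = 1" "card (carrier G) dvd e"
  shows "(z :: complex) ^ e = 1"
  using assms by (metis dvd_def power_mult power_one)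

lemma power_eq_inverse_power:
  assumes "z ^ card (carrier G) = 1" "card (carrier G) dvd d + e"
  shows "(z :: complex) ^ d = inverse (z ^ e)"
  using power_one_if_card_dvd[OF assms] by (metis inverse_unique mult.commute power_add)

text \<open>Only exponents modulo |G| matter, so the r-th power undoes the a-th power even where
  powers are not homomorphisms.\<close>

lemma bij_betw_pow:
  assumes "[r * a = 1] (mod card (carrier G))"
  shows "bij_betw (\<lambda>u. u [^] (a::nat)) (carrier G) (carrier G)"
proof -
  have eq: "u [^] (r * a) = u" if u: "u \<in> carrier G" for u
  proof -
    have "u [^] (r * a) = u [^] (1::nat)"
    \<comment> \<open>In the trivial group 1 mod |G| is 0, so the exponent does not reduce to 1
      there.\<close>
    proof (cases "card (carrier G) = 1")
      case True
      then have "carrier G = {\<one>}" using one_closed by (metis card_1_singletonE singletonD)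
      then show ?thesis using u by simp
    next
      case False
      have "u [^] (r * a) = u [^] ((r * a) mod card (carrier G))"
        using u pow_order_eq_1[OF u] by (metis Coset.order_def div_mult_mod_eq nat_pow_closed nat_pow_mult nat_pow_one nat_pow_pow l_one mult.commute)
      also have "(r * a) mod card (carrier G) = 1 mod card (carrier G)" using assms by (simp add: cong_def)
      also have "\<dots> = 1" using False card_carrier_pos by simp
      finally show ?thesis .
    qed
    then show ?thesis using u by simp
  qed
  show ?thesis
    by (rule bij_betw_byWitness[where f' = "\<lambda>u. u [^] r"])
       (use eq in \<open>auto simp: nat_pow_pow mult.commute\<close>)
qed

text \<open>With \<open>1 + l\<^sup>2 + r\<^sup>2 = 0\<close> and \<open>a = 1/r\<close> modulo the exponent, the forms
  \<open>u\<^sup>2 + v\<^sup>2\<close> and \<open>- u\<^sup>2 - v\<^sup>2\<close> are equivalent through shears and rescalings, which are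
  bijective also on a nonabelian group.\<close>

lemma sum_bichar_diagonal_squared_conj:
  assumes b: "sym_bichar b" and p: "prime p" "odd p" and card: "card (carrier G) = p ^ k"
  shows "(\<Sum>u\<in>carrier G. b u u)\<^sup>2 = (cnj (\<Sum>u\<in>carrier G. b u u))\<^sup>2"
proof -
  let ?N = "card (carrier G)"
  obtain l r a :: nat where lr: "?N dvd 1 + l\<^sup>2 + r\<^sup>2" and ra: "[r * a = 1] (mod ?N)"
    using odd_prime_power_minus_one_sum_two_squares_nat[OF p, of k] card by metis
  have "[(r * a)\<^sup>2 = 1] (mod ?N)" using cong_pow[OF ra, of 2] by simp
  then have ra2: "?N dvd x + 1" if "?N dvd x + (r * a)\<^sup>2" for x
    using that by (metis cong_add_lcancel_nat cong_dvd_iff)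
  define c where "c = l * a"
  have bN: "b u v ^ ?N = 1" if "u \<in> carrier G" "v \<in> carrier G" for u v
    using sym_bichar_power_card[OF b that] .
  have "?N dvd a\<^sup>2 * (1 + l\<^sup>2 + r\<^sup>2)" using lr by (rule dvd_mult)
  also have "a\<^sup>2 * (1 + l\<^sup>2 + r\<^sup>2) = (1 + l\<^sup>2) * a\<^sup>2 + (r * a)\<^sup>2"
    by (simp add: power2_eq_square algebra_simps)
  finally have e1: "?N dvd (1 + l\<^sup>2) * a\<^sup>2 + 1" by (rule ra2)
  have e2: "?N dvd (1 + c\<^sup>2) + a\<^sup>2"
    using e1 by (simp add: c_def power2_eq_square algebra_simps)
  note mult = sym_bichar_mult[OF b] and pow = sym_bichar_pow[OF b] and sym = sym_bicharD(1)[OF b]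
    and nz = sym_bichar_nonzero[OF b]
  let ?S = "\<Sum>u\<in>carrier G. b u u"
  have "?S\<^sup>2 = (\<Sum>u\<in>carrier G. b u u * (\<Sum>v\<in>carrier G. b (u [^] l \<otimes> v) (u [^] l \<otimes> v)))"
    unfolding power2_eq_square
    by (subst sum_distrib_right) (intro sum.cong refl, simp add: sum_translate(2)[of _ "\<lambda>v. b v v"])
  \<comment> \<open>The shear of v by u^l turns the exponent of b(u, u) from 1 into 1 + l^2, which
    is -r^2 modulo |G|.\<close>
  also have "\<dots> = (\<Sum>u\<in>carrier G. \<Sum>v\<in>carrier G. b u u ^ (1 + l\<^sup>2) * b u v ^ (2 * l) * b v v)"
    unfolding sum_distrib_left
  proof (intro sum.cong refl)
    fix u v assume uv: "u \<in> carrier G" "v \<in> carrier G"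
    then show "b u u * b (u [^] l \<otimes> v) (u [^] l \<otimes> v) = b u u ^ (1 + l\<^sup>2) * b u v ^ (2 * l) * b v v"
      using sym[of v u]
      by (simp add: mult pow power2_eq_square power_mult power_add mult_2 power_mult_distrib)
  qed
  also have "\<dots> = (\<Sum>v\<in>carrier G. \<Sum>u\<in>carrier G. b u u ^ (1 + l\<^sup>2) * b u v ^ (2 * l) * b v v)"
    by (rule sum.swap)
  also have "\<dots> = (\<Sum>v\<in>carrier G. \<Sum>u\<in>carrier G. inverse (b u u) * inverse (b (v [^] a) (v [^] a)))"
  proof (rule sum.cong[OF refl])
    fix v assume v: "v \<in> carrier G"
    \<comment> \<open>Rescaling u by a turns that exponent into -1.\<close>
    have "(\<Sum>u\<in>carrier G. b u u ^ (1 + l\<^sup>2) * b u v ^ (2 * l) * b v v)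
        = (\<Sum>u\<in>carrier G. b (u [^] a) (u [^] a) ^ (1 + l\<^sup>2) * b (u [^] a) v ^ (2 * l) * b v v)"
      by (rule sum.reindex_bij_betw[OF bij_betw_pow[OF ra], symmetric])
    also have "\<dots> = (\<Sum>u\<in>carrier G. inverse (b u u) * b u v ^ (2 * c) * b v v)"
    proof (intro sum.cong refl)
      fix u assume u: "u \<in> carrier G"
      have "b (u [^] a) (u [^] a) = b u u ^ a\<^sup>2"
        using u by (simp add: pow power2_eq_square power_mult)
      then have "b (u [^] a) (u [^] a) ^ (1 + l\<^sup>2) = b u u ^ ((1 + l\<^sup>2) * a\<^sup>2)"
        by (simp only: power_mult[symmetric] mult.commute)
      also have "\<dots> = inverse (b u u)" using power_eq_inverse_power[OF bN e1] u by simp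
      finally show "b (u [^] a) (u [^] a) ^ (1 + l\<^sup>2) * b (u [^] a) v ^ (2 * l) * b v v
          = inverse (b u u) * b u v ^ (2 * c) * b v v"
        using u v by (simp add: pow c_def mult_ac flip: power_mult)
    qed
    \<comment> \<open>The shear of u by v^c completes the square and removes the mixed term; b(v, v)
      is left with exponent 1 + c^2, which is -a^2 modulo |G|.\<close>
    also have "\<dots> = (\<Sum>u\<in>carrier G. inverse (b (u \<otimes> v [^] c) (u \<otimes> v [^] c)) * b (u \<otimes> v [^] c) v ^ (2 * c) * b v v)"
      using v by (simp add: sum_translate(1)[of _ "\<lambda>u. inverse (b u u) * b u v ^ (2 * c) * b v v"])
    also have "\<dots> = (\<Sum>u\<in>carrier G. inverse (b u u) * inverse (b (v [^] a) (v [^] a)))"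
    proof (intro sum.cong refl)
      fix u assume u: "u \<in> carrier G"
      have "inverse (b (u \<otimes> v [^] c) (u \<otimes> v [^] c)) * b (u \<otimes> v [^] c) v ^ (2 * c) * b v v
          = inverse (b u u) * b v v ^ (1 + c\<^sup>2)"
        using u v sym[OF v u] nz[OF u v] nz[OF v v]
        by (simp add: mult pow power2_eq_square power_mult power_add mult_2 power_mult_distrib field_simps)
      also have "b v v ^ (1 + c\<^sup>2) = inverse (b v v ^ a\<^sup>2)"
        using power_eq_inverse_power[OF bN e2] v by blast
      also have "b v v ^ a\<^sup>2 = b (v [^] a) (v [^] a)"
        using v by (simp add: pow power2_eq_square power_mult)
      finally show "inverse (b (u \<otimes> v [^] c) (u \<otimes> v [^] c)) * b (u \<otimes> v [^] c) v ^ (2 * c) * b v v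
          = inverse (b u u) * inverse (b (v [^] a) (v [^] a))" .
    qed
    finally show "(\<Sum>u\<in>carrier G. b u u ^ (1 + l\<^sup>2) * b u v ^ (2 * l) * b v v)
        = (\<Sum>u\<in>carrier G. inverse (b u u) * inverse (b (v [^] a) (v [^] a)))" .
  qed
  also have "\<dots> = (\<Sum>v\<in>carrier G. inverse (b (v [^] a) (v [^] a))) * (\<Sum>u\<in>carrier G. inverse (b u u))"
    by (simp add: sum_distrib_left sum_distrib_right mult.commute)
  \<comment> \<open>Undoing the rescaling of v by a leaves the square of the conjugate sum.\<close>
  also have "(\<Sum>v\<in>carrier G. inverse (b (v [^] a) (v [^] a))) = (\<Sum>v\<in>carrier G. inverse (b v v))"
    by (rule sum.reindex_bij_betw[OF bij_betw_pow[OF ra]])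
  also have "(\<Sum>v\<in>carrier G. inverse (b v v)) = cnj ?S"
    using sym_bichar_root_of_unity[OF b] root_of_unity_cnj by simp
  finally show ?thesis by (simp add: power2_eq_square)
qed

text \<open>Completing the square: B(g, g) / f(g)^2 is linear in g and 1 on the radical, so it
  equals B(g, t) for some t. With e the inverse of 2 modulo |G| and s = t^e, translating by s turns
  f into the pure form g |-> B(g, g)^e.\<close>

lemma quadratic_sum_phase_odd:
  assumes f: "quadratic f B" and fN: "\<And>g. g \<in> carrier G \<Longrightarrow> f g ^ card (carrier G) = 1"
    and p: "prime p" "odd p" and card: "card (carrier G) = p ^ k"
  shows "root_of_unity_phase (\<Sum>g\<in>carrier G. f g)"
proof (cases "(\<Sum>g\<in>carrier G. f g) = 0")
  case True
  then show ?thesis using root_of_unity_phase_nonneg[of 0] by simp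
next
  case False
  note B = quadraticD(1)[OF f]
  let ?N = "card (carrier G)"
  define e where "e = (?N + 1) div 2"
  have e: "2 * e = ?N + 1" using p(2) card by (simp add: e_def)
  have "linear_char (\<lambda>g. B g g / (f g)\<^sup>2)"
    unfolding linear_char_def using quadraticD(3,4)[OF f] sym_bichar_nonzero[OF B]
      sym_bichar_mult[OF B] sym_bicharD(1)[OF B]
    by (auto simp: power2_eq_square)
  moreover have "B r r / (f r)\<^sup>2 = 1" if "r \<in> radical B" for r
    using quadratic_radical[OF f False that] radicalD[OF that] by simp
  ultimately obtain t where t: "t \<in> carrier G" "\<And>g. g \<in> carrier G \<Longrightarrow> B g g / (f g)\<^sup>2 = B g t"
    using linear_char_represented[OF B] by blast
  define s where "s = t [^] e"
  have s: "s \<in> carrier G" using t by (simp add: s_def)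
  have Bs: "(B g s)\<^sup>2 = B g t" if g: "g \<in> carrier G" for g
  proof -
    have "(B g s)\<^sup>2 = B g t ^ (2 * e)"
      using sym_bichar_pow(2)[OF B t(1) g] by (simp add: s_def mult.commute flip: power_mult)
    then show ?thesis using e sym_bichar_power_card[OF B g t(1)] by simp
  qed
  define b where "b = (\<lambda>g h. B g h ^ e)"
  have b: "sym_bichar b" unfolding b_def by (rule sym_bichar_power[OF B])
  \<comment> \<open>The left side squares to B(g, g), and the e-th power undoes the squaring because
    the values have order dividing |G|.\<close>
  have eq: "f g * B g s = b g g" if g: "g \<in> carrier G" for g
  proof -
    have "(f g * B g s)\<^sup>2 = B g g"
      using t(2)[OF g] Bs[OF g] quadraticD(3)[OF f g] by (simp add: power_mult_distrib field_simps)
    moreover have "(f g * B g s) ^ (2 * e) = f g * B g s"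
      using e fN[OF g] sym_bichar_power_card[OF B g s] by (simp add: power_mult_distrib)
    ultimately show ?thesis by (simp add: b_def power_mult)
  qed
  have "(\<Sum>g\<in>carrier G. f g) = f s * (\<Sum>g\<in>carrier G. f g * B g s)"
    using quadratic_translate[OF f s] quadraticD(3)[OF f s] by simp
  also have "(\<Sum>g\<in>carrier G. f g * B g s) = (\<Sum>g\<in>carrier G. b g g)"
    using eq by simp
  finally have S: "(\<Sum>g\<in>carrier G. f g) = f s * (\<Sum>g\<in>carrier G. b g g)" .
  show ?thesis
    unfolding S
    using root_of_unity_phase_if_square_self_conj[OF sum_bichar_diagonal_squared_conj[OF b p card]]
      root_of_unity_phase_root[OF quadraticD(2)[OF f s]] root_of_unity_phase_mult by blast
qed

theorem quadratic_sum_phase: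
  assumes f: "quadratic f B" and fN: "\<And>g. g \<in> carrier G \<Longrightarrow> f g ^ card (carrier G) = 1"
    and p: "prime p" and card: "card (carrier G) = p ^ k"
  shows "root_of_unity_phase (\<Sum>g\<in>carrier G. f g)"
proof (cases "odd p")
  case True
  then show ?thesis using quadratic_sum_phase_odd[OF f fN p _ card] by blast
next
  case False
  then have "p = 2" using p primes_dvd_imp_eq two_is_prime_nat by blast
  then show ?thesis
    using quadratic_sum_phase_two_power[OF f, of k] sym_bichar_power_card[OF quadraticD(1)[OF f]] card
    by simp
qed

end

section \<open>Irreducible matrix representations\<close>

lemma mult_mat_entry:
  assumes "A \<in> carrier_mat n n" "B \<in> carrier_mat n n" "i < n" "j < n"
  shows "(A * B) $$ (i, j) = (\<Sum>k<n. A $$ (i, k) * B $$ (k, j))"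
  using assms by (auto simp: scalar_prod_def atLeast0LessThan intro: sum.cong)

lemma mult_mat_vec_entry:
  assumes "A \<in> carrier_mat n n" "v \<in> carrier_vec n" "i < n"
  shows "(A *\<^sub>v v) $ i = (\<Sum>k<n. A $$ (i, k) * v $ k)"
  using assms by (auto simp: scalar_prod_def atLeast0LessThan intro: sum.cong)

lemma mat_trace_entries: "A \<in> carrier_mat n n \<Longrightarrow> mat_trace A = (\<Sum>i<n. A $$ (i, i))"
  by (simp add: mat_trace_def)

lemma mat_trace_mult_commute:
  fixes A B :: "complex mat"
  assumes "A \<in> carrier_mat n n" "B \<in> carrier_mat n n"
  shows "mat_trace (A * B) = mat_trace (B * A)"
proof -
  have "mat_trace (A * B) = (\<Sum>i<n. \<Sum>k<n. A $$ (i, k) * B $$ (k, i))"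
    using mult_mat_entry[OF assms] assms by (simp add: mat_trace_entries[of _ n])
  also have "\<dots> = (\<Sum>k<n. \<Sum>i<n. B $$ (k, i) * A $$ (i, k))"
    by (subst sum.swap) (simp add: mult.commute)
  also have "\<dots> = mat_trace (B * A)"
    using mult_mat_entry[OF assms(2,1)] assms by (simp add: mat_trace_entries[of _ n])
  finally show ?thesis .
qed

lemma mat_trace_smult: "mat_trace (c \<cdot>\<^sub>m A) = c * mat_trace A" if "A \<in> carrier_mat n n"
  using that by (simp add: mat_trace_entries[of _ n] sum_distrib_left)

lemma mult_mat_vec_sum:
  fixes A :: "complex mat"
  assumes A: "A \<in> carrier_mat n n" and u: "\<And>j. u j \<in> carrier_vec n"
  shows "A *\<^sub>v vec n (\<lambda>i. \<Sum>j\<in>J. c j * u j $ i) = vec n (\<lambda>i. \<Sum>j\<in>J. c j * (A *\<^sub>v u j) $ i)"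
    (is "?l = ?r")
proof (rule eq_vecI)
  fix i assume "i < dim_vec ?r"
  then have i: "i < n" by simp
  have "?l $ i = (\<Sum>k<n. A $$ (i, k) * (\<Sum>j\<in>J. c j * u j $ k))"
    using i A by (subst mult_mat_vec_entry[of _ n]) auto
  also have "\<dots> = (\<Sum>j\<in>J. \<Sum>k<n. c j * (A $$ (i, k) * u j $ k))"
    unfolding sum_distrib_left by (subst sum.swap) (intro sum.cong refl, simp)
  also have "\<dots> = ?r $ i"
    using i A u by (simp add: mult_mat_vec_entry[of _ n] sum_distrib_left del: index_mult_mat_vec)
  finally show "?l $ i = ?r $ i" .
qed (use A in auto)

text \<open>There are fewer j-th than m-th roots of unity, so some m-th root w has w^j different
  from 1. Multiplication by w permutes the m-th roots and scales the sum by w^j.\<close>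

lemma sum_powers_roots_of_unity:
  assumes "0 < j" "j < m"
  shows "(\<Sum>z\<in>{z::complex. z ^ m = 1}. z ^ j) = 0"
proof -
  have "\<exists>w::complex. w ^ m = 1 \<and> w ^ j \<noteq> 1"
  proof (rule ccontr)
    assume "\<not> ?thesis"
    then have "{z::complex. z ^ m = 1} \<subseteq> {z. z ^ j = 1}" by auto
    then have "card {z::complex. z ^ m = 1} \<le> card {z::complex. z ^ j = 1}"
      using finite_roots_unity[of j] assms by (intro card_mono) auto
    then show False using card_roots_unity_eq[of m] card_roots_unity_eq[of j] assms by simp
  qed
  then obtain w :: complex where w: "w ^ m = 1" "w ^ j \<noteq> 1" by blast
  have w0: "w \<noteq> 0" using w(1) assms by (auto simp: power_0_left)
  have "bij_betw (\<lambda>z. w * z) {z. z ^ m = 1} {z. z ^ m = 1}"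
    by (rule bij_betw_byWitness[where f' = "\<lambda>z. z / w"])
       (use w(1) w0 in \<open>auto simp: power_mult_distrib power_divide\<close>)
  then have "(\<Sum>z\<in>{z. z ^ m = 1}. (w * z) ^ j) = (\<Sum>z\<in>{z::complex. z ^ m = 1}. z ^ j)"
    by (rule sum.reindex_bij_betw)
  then have "w ^ j * (\<Sum>z\<in>{z::complex. z ^ m = 1}. z ^ j) = (\<Sum>z\<in>{z::complex. z ^ m = 1}. z ^ j)"
    by (simp add: power_mult_distrib sum_distrib_left)
  then show ?thesis using w(2) by (metis mult_cancel_right1 mult.commute)
qed

section \<open>Schur's lemma, orthogonality and common eigenvectors\<close>

locale irreducible_rep = finite_group +
  fixes n :: nat and \<rho> :: "'a \<Rightarrow> complex mat"
  assumes irreducible: "irreducible_representation G n \<rho>"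
begin

lemma dim_pos: "n > 0"
  using irreducible by (simp add: irreducible_representation_def)

lemma rep_hom: "\<rho> \<in> hom G (GL_complex n)"
  using irreducible by (simp add: irreducible_representation_def representation_def)

lemma rep_carrier [simp]: "g \<in> carrier G \<Longrightarrow> \<rho> g \<in> carrier_mat n n"
proof -
  assume "g \<in> carrier G"
  then have "\<rho> g \<in> carrier (GL_complex n)" using rep_hom by (rule hom_in_carrier[rotated])
  then show ?thesis by (simp add: units_of_def Units_def ring_mat_def)
qed

lemma rep_dims [simp]: "g \<in> carrier G \<Longrightarrow> dim_row (\<rho> g) = n" "g \<in> carrier G \<Longrightarrow> dim_col (\<rho> g) = n"
  using rep_carrier by blast+

lemma rep_mult: "g \<in> carrier G \<Longrightarrow> h \<in> carrier G \<Longrightarrow> \<rho> (g \<otimes> h) = \<rho> g * \<rho> h"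
  using hom_mult[OF rep_hom] by (simp add: units_of_mult ring_mat_simps)

lemma rep_one: "\<rho> \<one> = 1\<^sub>m n"
proof -
  have "group (GL_complex n)"
    by (rule monoid.units_group) (rule ring.is_monoid[OF ring_mat])
  then show ?thesis
    using hom_one[OF rep_hom is_group] by (simp add: units_of_one ring_mat_simps)
qed

lemma rep_inv: "g \<in> carrier G \<Longrightarrow> \<rho> g * \<rho> (inv g) = 1\<^sub>m n" "g \<in> carrier G \<Longrightarrow> \<rho> (inv g) * \<rho> g = 1\<^sub>m n"
  by (simp_all flip: rep_mult add: rep_one)

text \<open>Schur's lemma: an eigenspace of M is nonzero and invariant, hence the whole
  space.\<close>

lemma commuting_matrix_scalar:
  assumes M: "M \<in> carrier_mat n n" and comm: "\<And>g. g \<in> carrier G \<Longrightarrow> \<rho> g * M = M * \<rho> g"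
  shows "\<exists>c. M = c \<cdot>\<^sub>m 1\<^sub>m n"
proof -
  obtain c where "eigenvalue M c"
    using spectrum_non_empty[OF M dim_pos] by (auto simp: spectrum_def)
  then obtain w where w: "w \<in> carrier_vec n" "w \<noteq> 0\<^sub>v n" "M *\<^sub>v w = c \<cdot>\<^sub>v w"
    using M by (auto simp: eigenvalue_def eigenvector_def)
  define W where "W = {v \<in> carrier_vec n. M *\<^sub>v v = c \<cdot>\<^sub>v v}"
  have "VectorSpace.subspace class_ring W (module_vec TYPE(complex) n)"
  proof (intro VectorSpace.subspace.intro submodule.intro)
    show "vectorspace class_ring (module_vec TYPE(complex) n)" by (rule vec_vs)
    then show "Module.module class_ring (module_vec TYPE(complex) n)" by (simp add: vectorspace_def)
    show "W \<subseteq> carrier (module_vec TYPE(complex) n)" by (auto simp: W_def module_vec_simps)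
    show "v \<oplus>\<^bsub>module_vec TYPE(complex) n\<^esub> u \<in> W" if "v \<in> W" "u \<in> W" for v u
      using that M by (auto simp: W_def module_vec_simps mult_add_distrib_mat_vec smult_add_distrib_vec)
    show "\<zero>\<^bsub>module_vec TYPE(complex) n\<^esub> \<in> W"
      using M by (auto simp: W_def module_vec_simps)
    show "a \<odot>\<^bsub>module_vec TYPE(complex) n\<^esub> v \<in> W" if "v \<in> W" for a v
      using that M by (auto simp: W_def module_vec_simps mult_mat_vec smult_smult_assoc mult.commute)
  qed
  moreover have "\<rho> g *\<^sub>v v \<in> W" if g: "g \<in> carrier G" and v: "v \<in> W" for g v
  proof -
    have vc: "v \<in> carrier_vec n" and Mv: "M *\<^sub>v v = c \<cdot>\<^sub>v v" using v by (auto simp: W_def)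
    have "M *\<^sub>v (\<rho> g *\<^sub>v v) = \<rho> g *\<^sub>v (M *\<^sub>v v)"
      using comm[OF g] assoc_mult_mat_vec[OF M rep_carrier[OF g] vc]
        assoc_mult_mat_vec[OF rep_carrier[OF g] M vc] by simp
    also have "\<dots> = c \<cdot>\<^sub>v (\<rho> g *\<^sub>v v)"
      unfolding Mv by (rule mult_mat_vec[OF rep_carrier[OF g] vc])
    finally show ?thesis using g vc mult_mat_vec_carrier[OF rep_carrier[OF g] vc] by (simp add: W_def)
  qed
  ultimately have "invariant_subspace G n \<rho> W"
    unfolding invariant_subspace_def by blast
  then have "W = {0\<^sub>v n} \<or> W = carrier_vec n"
    using irreducible unfolding irreducible_representation_def by blast
  moreover have "w \<in> W" using w by (simp add: W_def)
  ultimately have W: "W = carrier_vec n" using w(2) by auto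
  have "M = c \<cdot>\<^sub>m 1\<^sub>m n"
  proof (rule eq_matI)
    fix i j assume "i < dim_row (c \<cdot>\<^sub>m 1\<^sub>m n)" "j < dim_col (c \<cdot>\<^sub>m 1\<^sub>m n)"
    then have ij: "i < n" "j < n" by auto
    have "unit_vec n j \<in> W" using W by simp
    then have "(M *\<^sub>v unit_vec n j) $ i = (c \<cdot>\<^sub>v unit_vec n j) $ i" by (simp add: W_def)
    then show "M $$ (i, j) = (c \<cdot>\<^sub>m 1\<^sub>m n) $$ (i, j)"
      using M ij by simp
  qed (use M in auto)
  then show ?thesis by blast
qed

definition avg :: "complex mat \<Rightarrow> complex mat" where
  "avg M = mat n n (\<lambda>(i, j). \<Sum>g\<in>carrier G. (\<rho> g * M * \<rho> (inv g)) $$ (i, j))"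

text \<open>The sum of the conjugates of M, not divided by |G|, commutes with the representation, so
  it is scalar, and comparing traces finds the scalar. The entrywise form suits both the
  orthogonality relation and the sums of eigenvalues.\<close>

lemma avg_entry:
  assumes M: "M \<in> carrier_mat n n" and ij: "i < n" "j < n"
  shows "(\<Sum>g\<in>carrier G. (\<rho> g * M * \<rho> (inv g)) $$ (i, j))
    = (if i = j then of_nat (card (carrier G)) * mat_trace M / of_nat n else 0)"
proof -
  define X where "X g = \<rho> g * M * \<rho> (inv g)" for g
  have X: "X g \<in> carrier_mat n n" if "g \<in> carrier G" for g
    unfolding X_def using that M by (intro mult_carrier_mat[of _ n n]) auto
  have avg: "avg M = mat n n (\<lambda>(i, j). \<Sum>g\<in>carrier G. X g $$ (i, j))"
    by (simp add: avg_def X_def)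
  have avgc: "avg M \<in> carrier_mat n n" by (simp add: avg_def)
  have "\<rho> h * avg M = avg M * \<rho> h" if h: "h \<in> carrier G" for h
  proof (rule eq_matI)
    fix i j assume "i < dim_row (avg M * \<rho> h)" "j < dim_col (avg M * \<rho> h)"
    then have ij: "i < n" "j < n" using h by (auto simp: avg_def)
    have "(\<rho> h * avg M) $$ (i, j) = (\<Sum>k<n. \<rho> h $$ (i, k) * (\<Sum>g\<in>carrier G. X g $$ (k, j)))"
      using mult_mat_entry[OF rep_carrier[OF h] avgc ij] ij by (simp add: avg)
    also have "\<dots> = (\<Sum>g\<in>carrier G. \<Sum>k<n. \<rho> h $$ (i, k) * X g $$ (k, j))"
      unfolding sum_distrib_left by (rule sum.swap)
    \<comment> \<open>Passing \<open>\<rho> h\<close> through X(g) turns it into X(h g), and the sum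
      over g absorbs this translation.\<close>
    also have "\<dots> = (\<Sum>g\<in>carrier G. (X (h \<otimes> g) * \<rho> h) $$ (i, j))"
    proof (rule sum.cong[OF refl])
      fix g assume g: "g \<in> carrier G"
      note c = rep_carrier[OF h] rep_carrier[OF g] M rep_carrier[OF inv_closed[OF g]]
        rep_carrier[OF inv_closed[OF h]]
      have "X (h \<otimes> g) * \<rho> h = (\<rho> h * \<rho> g * M * (\<rho> (inv g) * \<rho> (inv h))) * \<rho> h"
        using g h by (simp add: X_def rep_mult inv_mult_group)
      also have "\<dots> = \<rho> h * \<rho> g * M * (\<rho> (inv g) * (\<rho> (inv h) * \<rho> h))"
        using c by (simp add: assoc_mult_mat[of _ n n _ n _ n])
      also have "\<dots> = \<rho> h * X g"
        unfolding rep_inv(2)[OF h] X_def using c by (simp add: assoc_mult_mat[of _ n n _ n _ n])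
      finally show "(\<Sum>k<n. \<rho> h $$ (i, k) * X g $$ (k, j)) = (X (h \<otimes> g) * \<rho> h) $$ (i, j)"
        using mult_mat_entry[OF rep_carrier[OF h] X[OF g] ij] by simp
    qed
    also have "\<dots> = (\<Sum>g\<in>carrier G. (X g * \<rho> h) $$ (i, j))"
      by (rule sum_translate(2)[OF h, of "\<lambda>g. (X g * \<rho> h) $$ (i, j)"])
    also have "\<dots> = (\<Sum>g\<in>carrier G. \<Sum>k<n. X g $$ (i, k) * \<rho> h $$ (k, j))"
      using mult_mat_entry[OF X rep_carrier[OF h] ij] by (intro sum.cong refl) blast
    also have "\<dots> = (avg M * \<rho> h) $$ (i, j)"
      unfolding mult_mat_entry[OF avgc rep_carrier[OF h] ij]
      by (subst sum.swap) (use ij in \<open>simp add: avg sum_distrib_right\<close>)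
    finally show "(\<rho> h * avg M) $$ (i, j) = (avg M * \<rho> h) $$ (i, j)" .
  qed (use h in \<open>auto simp: avg_def\<close>)
  then obtain c where c: "avg M = c \<cdot>\<^sub>m 1\<^sub>m n"
    using commuting_matrix_scalar[OF avgc] by blast
  have entry: "(\<Sum>g\<in>carrier G. X g $$ (i, j)) = (if i = j then c else 0)" if "i < n" "j < n" for i j
    using arg_cong[OF c, of "\<lambda>A. A $$ (i, j)"] that by (simp add: avg)
  have "of_nat n * c = (\<Sum>i<n. \<Sum>g\<in>carrier G. X g $$ (i, i))" using entry by simp
  also have "\<dots> = (\<Sum>g\<in>carrier G. mat_trace (X g))"
    by (subst sum.swap) (simp add: mat_trace_entries[OF X])
  also have "\<dots> = (\<Sum>g\<in>carrier G. mat_trace M)"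
  proof (rule sum.cong[OF refl])
    fix g assume g: "g \<in> carrier G"
    have "mat_trace (X g) = mat_trace (\<rho> (inv g) * (\<rho> g * M))"
      unfolding X_def using g M by (intro mat_trace_mult_commute[of _ n]) auto
    also have "\<rho> (inv g) * (\<rho> g * M) = \<rho> (inv g) * \<rho> g * M"
      using g M by (simp add: assoc_mult_mat[of _ n n _ n _ n])
    also have "\<dots> = M" unfolding rep_inv(2)[OF g] using M by simp
    finally show "mat_trace (X g) = mat_trace M" .
  qed
  finally have "c = of_nat (card (carrier G)) * mat_trace M / of_nat n"
    using dim_pos by (simp add: field_simps)
  then show ?thesis using entry[OF ij] by (simp add: X_def)
qed

definition chi :: "'a \<Rightarrow> complex" where
  "chi g = mat_trace (\<rho> g)"

lemma chi_one: "chi \<one> = of_nat n"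
  by (simp add: chi_def rep_one mat_trace_def)

lemma chi_conj: "g \<in> carrier G \<Longrightarrow> x \<in> carrier G \<Longrightarrow> chi (g \<otimes> x \<otimes> inv g) = chi x"
proof -
  assume g: "g \<in> carrier G" and x: "x \<in> carrier G"
  have "chi (g \<otimes> x \<otimes> inv g) = mat_trace (\<rho> g * \<rho> x * \<rho> (inv g))"
    using g x by (simp add: chi_def rep_mult)
  also have "\<dots> = mat_trace (\<rho> (inv g) * (\<rho> g * \<rho> x))"
    using g x by (intro mat_trace_mult_commute[of _ n]) auto
  also have "\<rho> (inv g) * (\<rho> g * \<rho> x) = \<rho> x"
    using g x by (simp flip: rep_mult)
  finally show ?thesis by (simp add: chi_def)
qed

text \<open>First orthogonality relation, by averaging matrix units: the (i, k) entry of the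
  conjugate of \<open>E i k\<close> is a product of diagonal entries of \<open>\<rho> g\<close> and
  \<open>\<rho> (inv g)\<close>. The value at \<open>inv g\<close> becomes a complex conjugate only
  later, for good elements, in \<open>good_chi_value\<close>.\<close>

lemma sum_chi_chi_inv: "(\<Sum>g\<in>carrier G. chi g * chi (inv g)) = of_nat (card (carrier G))"
proof -
  define E :: "nat \<Rightarrow> nat \<Rightarrow> complex mat"
    where "E i k = mat n n (\<lambda>(a, b). if a = i \<and> b = k then 1 else 0)" for i k
  have E: "E i k \<in> carrier_mat n n" for i k by (simp add: E_def)
  have entry: "(\<rho> g * E i k * \<rho> (inv g)) $$ (i, k) = \<rho> g $$ (i, i) * \<rho> (inv g) $$ (k, k)"
    if g: "g \<in> carrier G" and ik: "i < n" "k < n" for g i k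
  proof -
    have 1: "(\<rho> g * E i k) $$ (i, b) = (if b = k then \<rho> g $$ (i, i) else 0)" if b: "b < n" for b
    proof -
      have "(\<rho> g * E i k) $$ (i, b) = (\<Sum>a<n. \<rho> g $$ (i, a) * (if a = i \<and> b = k then 1 else 0))"
        unfolding mult_mat_entry[OF rep_carrier[OF g] E ik(1) b] using b by (simp add: E_def)
      also have "\<dots> = (\<Sum>a<n. if a = i then (if b = k then \<rho> g $$ (i, i) else 0) else 0)"
        by (intro sum.cong) auto
      finally show ?thesis using ik by simp
    qed
    have "(\<rho> g * E i k * \<rho> (inv g)) $$ (i, k) = (\<Sum>b<n. (\<rho> g * E i k) $$ (i, b) * \<rho> (inv g) $$ (b, k))"
      using g ik E by (intro mult_mat_entry mult_carrier_mat[of _ n n]) auto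
    also have "\<dots> = (\<Sum>b<n. if b = k then \<rho> g $$ (i, i) * \<rho> (inv g) $$ (k, k) else 0)"
      by (intro sum.cong refl) (simp add: 1)
    finally show ?thesis using ik by simp
  qed
  have trace: "mat_trace (E i k) = (if i = k then 1 else 0)" if "i < n" for i k
  proof -
    have "mat_trace (E i k) = (\<Sum>a<n. if a = i then (if i = k then 1 else 0) else 0)"
      by (subst mat_trace_entries[OF E]) (auto simp: E_def intro!: sum.cong)
    then show ?thesis using that by simp
  qed
  have "(\<Sum>g\<in>carrier G. chi g * chi (inv g))
      = (\<Sum>g\<in>carrier G. \<Sum>i<n. \<Sum>k<n. (\<rho> g * E i k * \<rho> (inv g)) $$ (i, k))"
    using entry by (intro sum.cong refl) (simp add: chi_def mat_trace_entries[of _ n] sum_product)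
  also have "\<dots> = (\<Sum>i<n. \<Sum>k<n. \<Sum>g\<in>carrier G. (\<rho> g * E i k * \<rho> (inv g)) $$ (i, k))"
    by (subst sum.swap) (intro sum.cong refl, rule sum.swap)
  also have "\<dots> = (\<Sum>i<n. \<Sum>k<n. if i = k then of_nat (card (carrier G)) / of_nat n else 0)"
    using avg_entry[OF E] trace by (intro sum.cong refl) simp
  also have "\<dots> = of_nat (card (carrier G))"
    using dim_pos by simp
  finally show ?thesis .
qed

text \<open>By \<open>avg_entry\<close> the sum of the matrices of all conjugates of x is the scalar
  |G| chi(x) / n. Applied to v it is also the sum of the eigenvalues, and a nonzero coordinate of v
  compares the two.\<close>

lemma sum_eigenvalues_conjugates:
  assumes x: "x \<in> carrier G" and v: "v \<in> carrier_vec n" "v \<noteq> 0\<^sub>v n"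
    and eig: "\<And>g. g \<in> carrier G \<Longrightarrow> \<rho> (g \<otimes> x \<otimes> inv g) *\<^sub>v v = m g \<cdot>\<^sub>v v"
  shows "(\<Sum>g\<in>carrier G. m g) = of_nat (card (carrier G)) * chi x / of_nat n"
proof -
  obtain i where i: "i < n" "v $ i \<noteq> 0"
    using v by (metis carrier_vecD eq_vecI index_zero_vec)
  have "(\<Sum>g\<in>carrier G. m g) * v $ i = (\<Sum>g\<in>carrier G. (\<rho> (g \<otimes> x \<otimes> inv g) *\<^sub>v v) $ i)"
    using eig i v by (simp add: sum_distrib_right del: index_mult_mat_vec)
  also have "\<dots> = (\<Sum>g\<in>carrier G. \<Sum>j<n. (\<rho> g * \<rho> x * \<rho> (inv g)) $$ (i, j) * v $ j)"
  proof (rule sum.cong[OF refl])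
    fix g assume g: "g \<in> carrier G"
    show "(\<rho> (g \<otimes> x \<otimes> inv g) *\<^sub>v v) $ i = (\<Sum>j<n. (\<rho> g * \<rho> x * \<rho> (inv g)) $$ (i, j) * v $ j)"
      using mult_mat_vec_entry[OF rep_carrier v(1) i(1), of "g \<otimes> x \<otimes> inv g"] g x
      by (simp add: rep_mult)
  qed
  also have "\<dots> = (\<Sum>j<n. (\<Sum>g\<in>carrier G. (\<rho> g * \<rho> x * \<rho> (inv g)) $$ (i, j)) * v $ j)"
    by (subst sum.swap) (simp add: sum_distrib_right)
  also have "\<dots> = (\<Sum>j<n. if i = j then of_nat (card (carrier G)) * chi x / of_nat n * v $ i else 0)"
    using avg_entry[OF rep_carrier[OF x] i(1)] by (intro sum.cong refl) (simp add: chi_def)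
  also have "\<dots> = of_nat (card (carrier G)) * chi x / of_nat n * v $ i"
    using i by simp
  finally show ?thesis using mult_right_cancel[OF i(2)] by blast
qed

text \<open>Induction on the set: a common eigenvector v of A is split into its components under
  \<open>\<rho> d\<close>. They keep the eigenvalues of A because d commutes with A, and some
  component is nonzero.\<close>

lemma common_eigenvector:
  assumes "finite A" "A \<subseteq> carrier G"
    and "\<And>a b. a \<in> A \<Longrightarrow> b \<in> A \<Longrightarrow> a \<otimes> b = b \<otimes> a"
  shows "\<exists>v\<in>carrier_vec n. v \<noteq> 0\<^sub>v n \<and> (\<forall>a\<in>A. \<exists>m. \<rho> a *\<^sub>v v = m \<cdot>\<^sub>v v)"
  using assms
proof (induction A rule: finite_induct)
  case empty
  have "unit_vec n 0 \<noteq> (0\<^sub>v n :: complex vec)"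
    using dim_pos by (metis index_unit_vec(2) index_zero_vec(1) zero_neq_one)
  then show ?case by (intro bexI[of _ "unit_vec n 0"]) auto
next
  case (insert d A)
  then obtain v where v: "v \<in> carrier_vec n" "v \<noteq> 0\<^sub>v n" "\<forall>a\<in>A. \<exists>m. \<rho> a *\<^sub>v v = m \<cdot>\<^sub>v v"
    by auto
  have d: "d \<in> carrier G" using insert.prems by simp
  define m where "m = card (carrier G)"
  have m: "m > 0" using card_carrier_pos by (simp add: m_def)
  define u where "u j = \<rho> (d [^] (j::nat)) *\<^sub>v v" for j
  have u: "u j \<in> carrier_vec n" for j
    unfolding u_def by (rule mult_mat_vec_carrier[OF rep_carrier v(1)]) (use d in simp)
  have u0: "u 0 = v" using v by (simp add: u_def rep_one)
  have um: "u m = v"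
    using v d pow_order_eq_1[OF d] by (simp add: u_def rep_one m_def Coset.order_def)
  have du: "\<rho> d *\<^sub>v u j = u (Suc j)" for j
    unfolding u_def nat_pow_Suc2[OF d]
    using assoc_mult_mat_vec[OF rep_carrier[OF d] rep_carrier v(1), of "d [^] j"] d
    by (simp add: rep_mult)
  \<comment> \<open>Up to the factor m, this is the projection of v to the eigenvalue z^-1 of
    \<open>\<rho> d\<close>; over all m-th roots of unity z the projections add up to v.\<close>
  define w where "w z = vec n (\<lambda>i. \<Sum>j<m. z ^ j * u j $ i)" for z :: complex
  have w: "w z \<in> carrier_vec n" for z by (simp add: w_def)
  obtain i where i: "i < n" "v $ i \<noteq> 0"
    using v by (metis carrier_vecD eq_vecI index_zero_vec)
  have "(\<Sum>z\<in>{z. z ^ m = 1}. w z $ i) = (\<Sum>j<m. (\<Sum>z\<in>{z::complex. z ^ m = 1}. z ^ j) * u j $ i)"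
    using i by (simp add: w_def sum_distrib_right) (rule sum.swap)
  also have "\<dots> = (\<Sum>j<m. if j = 0 then of_nat m * v $ i else 0)"
  proof (intro sum.cong refl)
    fix j assume "j \<in> {..<m}"
    then show "(\<Sum>z\<in>{z::complex. z ^ m = 1}. z ^ j) * u j $ i = (if j = 0 then of_nat m * v $ i else 0)"
      using sum_powers_roots_of_unity[of j m] card_roots_unity_eq[of m] m u0 by auto
  qed
  also have "\<dots> = of_nat m * v $ i" using m by simp
  finally have "(\<Sum>z\<in>{z. z ^ m = 1}. w z $ i) \<noteq> 0" using i m by simp
  then obtain z where z: "z ^ m = 1" "w z $ i \<noteq> 0"
    by (metis (mono_tags, lifting) mem_Collect_eq sum.neutral)
  have z0: "z \<noteq> 0" using z m by (auto simp: power_0_left)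
  have wz: "w z \<noteq> 0\<^sub>v n" using z i by (metis index_zero_vec(1))
  have "\<rho> d *\<^sub>v w z = inverse z \<cdot>\<^sub>v w z"
  proof -
    have "\<rho> d *\<^sub>v w z = vec n (\<lambda>i. \<Sum>j<m. z ^ j * u (Suc j) $ i)"
      unfolding w_def mult_mat_vec_sum[OF rep_carrier[OF d] u] du ..
    also have "\<dots> = inverse z \<cdot>\<^sub>v w z"
    proof (rule eq_vecI)
      fix k assume "k < dim_vec (inverse z \<cdot>\<^sub>v w z)"
      then have k: "k < n" by (simp add: w_def)
      have "z * (\<Sum>j<m. z ^ j * u (Suc j) $ k) = (\<Sum>j<m. z ^ Suc j * u (Suc j) $ k)"
        by (simp add: sum_distrib_left mult_ac)
      \<comment> \<open>The sum is shifted cyclically: the terms for m and for 0 agree since z^m = 1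
        and u(m) = u(0) = v.\<close>
      also have "\<dots> = (\<Sum>j<m. z ^ j * u j $ k)"
        using sum.lessThan_Suc_shift[of "\<lambda>j. z ^ j * u j $ k" m]
          sum.lessThan_Suc[of "\<lambda>j. z ^ j * u j $ k" m] z(1) um u0 by simp
      finally show "vec n (\<lambda>i. \<Sum>j<m. z ^ j * u (Suc j) $ i) $ k = (inverse z \<cdot>\<^sub>v w z) $ k"
        using k z0 by (simp add: w_def field_simps)
    qed (simp add: w_def)
    finally show ?thesis .
  qed
  moreover have "\<exists>b. \<rho> a *\<^sub>v w z = b \<cdot>\<^sub>v w z" if a: "a \<in> A" for a
  proof -
    obtain b where b: "\<rho> a *\<^sub>v v = b \<cdot>\<^sub>v v" using v(3) a by blast
    have ac: "a \<in> carrier G" using insert.prems(1) a by auto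
    have ad: "a \<otimes> d [^] j = d [^] j \<otimes> a" for j :: nat
      using group_commutes_pow[of d a j] insert.prems(2)[of d a] ac d a by simp
    have "\<rho> a *\<^sub>v u j = b \<cdot>\<^sub>v u j" for j
    proof -
      have dj: "d [^] j \<in> carrier G" using d by simp
      have "\<rho> a *\<^sub>v u j = \<rho> (a \<otimes> d [^] j) *\<^sub>v v"
        using assoc_mult_mat_vec[OF rep_carrier[OF ac] rep_carrier[OF dj] v(1)]
        by (simp add: u_def rep_mult[OF ac dj])
      also have "\<dots> = \<rho> (d [^] j) *\<^sub>v (\<rho> a *\<^sub>v v)"
        unfolding ad using assoc_mult_mat_vec[OF rep_carrier[OF dj] rep_carrier[OF ac] v(1)]
        by (simp add: rep_mult[OF dj ac])
      also have "\<dots> = b \<cdot>\<^sub>v u j"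
        unfolding b u_def by (rule mult_mat_vec[OF rep_carrier[OF dj] v(1)])
      finally show ?thesis .
    qed
    then have "\<rho> a *\<^sub>v w z = vec n (\<lambda>i. \<Sum>j<m. z ^ j * (b \<cdot>\<^sub>v u j) $ i)"
      unfolding w_def mult_mat_vec_sum[OF rep_carrier[OF ac] u] by simp
    also have "\<dots> = b \<cdot>\<^sub>v w z"
      by (rule eq_vecI) (use u in \<open>auto simp: w_def sum_distrib_left mult_ac carrier_vecD[OF u] intro!: sum.cong\<close>)
    finally show ?thesis by blast
  qed
  ultimately show ?case using w wz by (intro bexI[of _ "w z"]) auto
qed

lemma center_scalar: "z \<in> center \<Longrightarrow> \<exists>c. \<rho> z = c \<cdot>\<^sub>m 1\<^sub>m n"
  using centerD(1)[of z] centerD(2)[of z]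
  by (intro commuting_matrix_scalar) (simp_all flip: rep_mult)

end

section \<open>Characters of groups of class at most three\<close>

context group
begin

lemma conj_class_eq: "x \<in> carrier G \<Longrightarrow> conj_class G x = (\<lambda>g. g \<otimes> x \<otimes> inv g) ` carrier G"
  by (auto simp: conj_class_def orbit_def conj_action_def)

lemma conj_action_group_action: "group_action G (carrier G) (conj_action G)"
  unfolding conj_action_def by (rule action_by_conjugation)

lemma conj_classes_eq: "conj_classes G = conj_class G ` carrier G"
  by (auto simp: conj_classes_def orbits_def conj_class_def)

lemma conj_class_refl: "x \<in> carrier G \<Longrightarrow> x \<in> conj_class G x"
  unfolding conj_class_def by (rule group_action.orbit_refl[OF conj_action_group_action])

lemma conj_class_eq_if_mem:
  assumes "x \<in> carrier G" "y \<in> conj_class G x"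
  shows "conj_class G y = conj_class G x"
proof -
  interpret A: group_action G "carrier G" "conj_action G" by (rule conj_action_group_action)
  have y: "y \<in> carrier G" using assms by (auto simp: conj_class_eq)
  have "y \<in> conj_class G y \<inter> conj_class G x" using conj_class_refl[OF y] assms by blast
  moreover have "conj_class G y \<in> orbits G (carrier G) (conj_action G)"
    "conj_class G x \<in> orbits G (carrier G) (conj_action G)"
    using y assms(1) by (auto simp: orbits_def conj_class_def)
  ultimately show ?thesis using A.disjoint_union by blast
qed

lemma card_conj_class:
  assumes "x \<in> carrier G"
  shows "card (conj_class G x) * card {h \<in> carrier G. h \<otimes> x = x \<otimes> h} = card (carrier G)"
proof -
  interpret A: group_action G "carrier G" "conj_action G" by (rule conj_action_group_action)
  have "stabilizer G (conj_action G) x = {h \<in> carrier G. h \<otimes> x = x \<otimes> h}"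
  proof -
    have "h \<otimes> x \<otimes> inv h = x \<longleftrightarrow> h \<otimes> x = x \<otimes> h" if "h \<in> carrier G" for h
      using commute_conj[OF that assms] commute_if_conj[OF that assms] by blast
    then show ?thesis using assms by (auto simp: stabilizer_def conj_action_def)
  qed
  then show ?thesis
    using A.orbit_stabilizer_theorem[OF assms] by (simp add: conj_class_def Coset.order_def)
qed

end

context finite_group
begin

lemma finite_conj_class: "x \<in> carrier G \<Longrightarrow> finite (conj_class G x)"
  using finite_carrier by (simp add: conj_class_eq)

lemma finite_conj_classes: "finite (conj_classes G)"
  using finite_carrier by (simp add: conj_classes_eq)

lemma card_conj_class_pos: "x \<in> carrier G \<Longrightarrow> card (conj_class G x) > 0"
  using finite_conj_class conj_class_refl card_gt_0_iff by blast

text \<open>S is a union of classes, and the weights on each class add up to 1.\<close>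

lemma sum_inverse_card_conj_class:
  assumes S: "S \<subseteq> carrier G" and conj: "\<And>x g. x \<in> S \<Longrightarrow> g \<in> carrier G \<Longrightarrow> g \<otimes> x \<otimes> inv g \<in> S"
  shows "(\<Sum>x\<in>S. 1 / of_nat (card (conj_class G x))) = (of_nat (card {C \<in> conj_classes G. C \<subseteq> S}) :: complex)"
proof -
  interpret A: group_action G "carrier G" "conj_action G" by (rule conj_action_group_action)
  let ?f = "\<lambda>x. if x \<in> S then 1 / of_nat (card (conj_class G x)) else (0::complex)"
  have closed: "b \<in> S" if "a \<in> S" "a \<in> carrier G" "b \<in> conj_class G a" for a b
    using conj[OF that(1)] that(3) unfolding conj_class_eq[OF that(2)] by blast
  have class_sum: "(\<Sum>x\<in>C. ?f x) = (if C \<subseteq> S then 1 else 0)" if C: "C \<in> conj_classes G" for C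
  proof -
    obtain x where x: "x \<in> carrier G" "C = conj_class G x" using C by (auto simp: conj_classes_eq)
    have in_S: "y \<in> S \<longleftrightarrow> x \<in> S" if "y \<in> C" for y
    proof -
      have yx: "y \<in> conj_class G x" using that x(2) by simp
      then have y: "y \<in> carrier G" using x(1) by (auto simp: conj_class_eq)
      have "x \<in> conj_class G y"
        unfolding conj_class_eq_if_mem[OF x(1) yx] by (rule conj_class_refl[OF x(1)])
      then show ?thesis using yx closed x(1) y by blast
    qed
    have xC: "x \<in> C" using conj_class_refl x by simp
    have "(\<Sum>y\<in>C. ?f y) = (\<Sum>y\<in>C. if x \<in> S then 1 / of_nat (card C) else 0)"
      using in_S conj_class_eq_if_mem[OF x(1)] x(2) by (intro sum.cong refl) simp
    also have "\<dots> = (if x \<in> S then 1 else 0)"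
      using card_conj_class_pos[OF x(1)] x(2) by simp
    also have "x \<in> S \<longleftrightarrow> C \<subseteq> S" using in_S xC by blast
    finally show ?thesis .
  qed
  have "(\<Sum>x\<in>S. 1 / of_nat (card (conj_class G x))) = (\<Sum>x\<in>carrier G. ?f x)"
    using S finite_carrier by (intro sum.mono_neutral_cong_left) auto
  also have "\<dots> = (\<Sum>C\<in>conj_classes G. \<Sum>x\<in>C. ?f x)"
    unfolding conj_classes_def by (rule A.disjoint_sum[OF finite_carrier, symmetric])
  also have "\<dots> = (\<Sum>C\<in>conj_classes G. if C \<subseteq> S then 1 else 0)"
    using class_sum by (intro sum.cong refl) blast
  also have "\<dots> = of_nat (card {C \<in> conj_classes G. C \<subseteq> S})"
    using finite_conj_classes by (simp flip: sum.inter_filter)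
  finally show ?thesis .
qed

end

section \<open>Values and support for an injective representation\<close>

locale faithful_class3_rep = irreducible_rep + group_class3 +
  fixes p k :: nat
  assumes inj: "inj_on \<rho> (carrier G)"
    and prime: "prime p"
    and card_carrier: "card (carrier G) = p ^ k"
begin

text \<open>\<open>\<rho> z\<close> is scalar, so the eigenvalue 1 on a single vector makes it the
  identity, and injectivity gives z = 1.\<close>

lemma eigen_center_one:
  assumes z: "z \<in> center" and v: "v \<in> carrier_vec n" "v \<noteq> 0\<^sub>v n" and eig: "\<rho> z *\<^sub>v v = v"
  shows "z = \<one>"
proof -
  obtain c where c: "\<rho> z = c \<cdot>\<^sub>m 1\<^sub>m n" using center_scalar[OF z] by blast
  obtain i where i: "i < n" "v $ i \<noteq> 0"
    using v by (metis carrier_vecD eq_vecI index_zero_vec)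
  have "v $ i = (\<rho> z *\<^sub>v v) $ i" using eig by simp
  also have "\<dots> = (\<Sum>k<n. \<rho> z $$ (i, k) * v $ k)"
    by (rule mult_mat_vec_entry[OF rep_carrier[OF centerD(1)[OF z]] v(1) i(1)])
  also have "\<dots> = (\<Sum>k<n. if k = i then c * v $ i else 0)"
    unfolding c using i by (intro sum.cong) auto
  also have "\<dots> = c * v $ i" using i by simp
  finally have "c * v $ i = v $ i" by simp
  then have "c = 1" using i by simp
  then have "\<rho> z = \<rho> \<one>" using c rep_one by auto
  then show ?thesis using inj z centerD(1) by (meson inj_onD one_closed)
qed

text \<open>With z = [y, x] acting as a scalar c, conjugating x to z x gives chi(x) = c chi(x),
  hence c = 1.\<close>

lemma chi_nonzero_imp_good:
  assumes x: "x \<in> carrier G" and nz: "chi x \<noteq> 0"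
  shows "good x"
proof -
  have "commutator G y x = \<one>" if y: "y \<in> carrier G" and z: "commutator G y x \<in> center" for y
  proof -
    let ?z = "commutator G y x"
    obtain c where c: "\<rho> ?z = c \<cdot>\<^sub>m 1\<^sub>m n" using center_scalar[OF z] by blast
    have "y \<otimes> x \<otimes> inv y = ?z \<otimes> x" using x y by (simp add: commutator_def m_assoc)
    then have "chi x = chi (?z \<otimes> x)" using chi_conj[OF y x] by simp
    also have "\<dots> = c * chi x"
      using x y by (simp add: chi_def rep_mult c mult_smult_assoc_mat[of _ n n _ n] mat_trace_smult[of _ n])
    finally have "c = 1" using nz by simp
    then have "\<rho> ?z = \<rho> \<one>" using c rep_one by auto
    then show ?thesis using inj x y by (meson commutator_closed inj_onD one_closed)
  qed
  then show ?thesis using x by (simp add: good_def)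
qed

text \<open>If \<mu> is the eigencharacter of a common eigenvector of \<open>center_cent\<close>,
  the mean of \<mu>(g x g^-1) over g is chi(x) / n. Factoring out \<mu>(x) leaves the Gauss sum of g
  |-> \<mu>([g, x]). The conjugation formula comes from the same mean for x^-1.\<close>

lemma good_chi_value:
  assumes x: "good x"
  shows "chi (inv x) = cnj (chi x)"
    and "root_of_unity (chi x * complex_of_real (sqrt (real (card (conj_class G x)))) / of_nat n)"
proof -
  let ?N = "card (carrier G)"
  have xD: "x \<in> center_cent" and xc: "x \<in> carrier G"
    using x good_in_center_cent by (auto simp: good_def)
  have D: "d \<in> carrier G" if "d \<in> center_cent" for d using that by (rule center_centD(2))
  have "\<exists>v\<in>carrier_vec n. v \<noteq> 0\<^sub>v n \<and> (\<forall>a\<in>center_cent. \<exists>m. \<rho> a *\<^sub>v v = m \<cdot>\<^sub>v v)"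
  proof (rule common_eigenvector)
    show "center_cent \<subseteq> carrier G" using D by blast
    then show "finite center_cent" using finite_carrier finite_subset by blast
    show "a \<otimes> b = b \<otimes> a" if "a \<in> center_cent" "b \<in> center_cent" for a b
      using that center_centD(1,3) by blast
  qed
  then obtain v where v: "v \<in> carrier_vec n" "v \<noteq> 0\<^sub>v n"
    and "\<forall>a\<in>center_cent. \<exists>m. \<rho> a *\<^sub>v v = m \<cdot>\<^sub>v v" by blast
  then obtain \<mu> where \<mu>: "\<And>a. a \<in> center_cent \<Longrightarrow> \<rho> a *\<^sub>v v = \<mu> a \<cdot>\<^sub>v v" by metis
  obtain i where i: "i < n" "v $ i \<noteq> 0"
    using v by (metis carrier_vecD eq_vecI index_zero_vec)
  have smult_eq: "a = b" if "a \<cdot>\<^sub>v v = b \<cdot>\<^sub>v v" for a b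
    using arg_cong[OF that, of "\<lambda>w. w $ i"] i v by simp
  have \<mu>_mult: "\<mu> (a \<otimes> b) = \<mu> a * \<mu> b" if a: "a \<in> center_cent" and b: "b \<in> center_cent" for a b
  proof (rule smult_eq)
    have "\<mu> (a \<otimes> b) \<cdot>\<^sub>v v = \<rho> a *\<^sub>v (\<rho> b *\<^sub>v v)"
      using \<mu>[OF center_cent_mult[OF a b]] assoc_mult_mat_vec[OF rep_carrier[OF D[OF a]] rep_carrier[OF D[OF b]] v(1)]
      by (simp add: rep_mult D a b)
    also have "\<dots> = (\<mu> a * \<mu> b) \<cdot>\<^sub>v v"
      unfolding \<mu>[OF b] mult_mat_vec[OF rep_carrier[OF D[OF a]] v(1)] \<mu>[OF a]
      by (simp add: smult_smult_assoc mult.commute)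
    finally show "\<mu> (a \<otimes> b) \<cdot>\<^sub>v v = (\<mu> a * \<mu> b) \<cdot>\<^sub>v v" .
  qed
  have one_D: "\<one> \<in> center_cent" using center_le_center_cent one_in_center by blast
  have \<mu>_one: "\<mu> \<one> = 1"
    using \<mu>[OF one_D] v(1) by (intro smult_eq) (simp add: rep_one)
  have \<mu>_pow: "\<mu> (a [^] (j::nat)) = \<mu> a ^ j" if "a \<in> center_cent" for a j
    using that by (induction j) (simp_all add: \<mu>_one \<mu>_mult center_cent_pow)
  have \<mu>_card: "\<mu> a ^ ?N = 1" if "a \<in> center_cent" for a
    using \<mu>_pow[OF that, of ?N] pow_order_eq_1[OF D[OF that]] \<mu>_one by (simp add: Coset.order_def)
  have \<mu>_root: "root_of_unity (\<mu> a)" if "a \<in> center_cent" for a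
    unfolding root_of_unity_def using \<mu>_card[OF that] card_carrier_pos by blast
  have \<mu>_inv: "\<mu> (inv a) = cnj (\<mu> a)" if a: "a \<in> center_cent" for a
  proof -
    have "\<mu> a * \<mu> (inv a) = 1"
      using \<mu>_mult[OF a center_cent_inv[OF a]] D[OF a] \<mu>_one by simp
    then show ?thesis using root_of_unity_cnj[OF \<mu>_root[OF a]] by (simp add: inverse_unique)
  qed
  \<comment> \<open>Faithfulness of \<mu> on the center is what identifies the radical
    below.\<close>
  have \<mu>_center: "z = \<one>" if z: "z \<in> center" and "\<mu> z = 1" for z
    using eigen_center_one[OF z v] \<mu>[OF center_le_center_cent[OF z]] that(2) by simp

  have conj_sum: "(\<Sum>g\<in>carrier G. \<mu> (g \<otimes> x \<otimes> inv g)) = of_nat ?N * chi x / of_nat n"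
    by (rule sum_eigenvalues_conjugates[OF xc v]) (rule \<mu>[OF center_cent_conj[OF xD]])
  have "(\<Sum>g\<in>carrier G. \<mu> (g \<otimes> inv x \<otimes> inv g)) = of_nat ?N * chi (inv x) / of_nat n"
    by (rule sum_eigenvalues_conjugates[OF inv_closed[OF xc] v])
       (rule \<mu>[OF center_cent_conj[OF center_cent_inv[OF xD]]])
  moreover have "\<mu> (g \<otimes> inv x \<otimes> inv g) = cnj (\<mu> (g \<otimes> x \<otimes> inv g))" if g: "g \<in> carrier G" for g
  proof -
    have "inv (g \<otimes> x \<otimes> inv g) = g \<otimes> inv x \<otimes> inv g"
      using g xc by (simp add: inv_mult_group m_assoc)
    then show ?thesis using \<mu>_inv[OF center_cent_conj[OF xD g]] by simp
  qed
  ultimately have "of_nat ?N * chi (inv x) / of_nat n = cnj (of_nat ?N * chi x / of_nat n)"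
    by (simp flip: conj_sum)
  then have "(of_nat ?N / of_nat n) * chi (inv x) = (of_nat ?N / of_nat n) * cnj (chi x)" by simp
  moreover have "of_nat ?N / of_nat n \<noteq> (0 :: complex)" using card_carrier_pos dim_pos by simp
  ultimately show "chi (inv x) = cnj (chi x)" using mult_left_cancel by blast

  define f where "f g = \<mu> (commutator G g x)" for g
  define B where "B g h = \<mu> (commutator G g (commutator G h x))" for g h
  have cD: "commutator G g x \<in> center_cent" if "g \<in> carrier G" for g
    using commutator_in_center_cent[OF xD that] .
  have c2: "commutator G g x \<in> second_center" if "g \<in> carrier G" for g
    using commutators_in_second_center[OF that xc] .
  have ccZ: "commutator G g (commutator G h x) \<in> center" if "g \<in> carrier G" "h \<in> carrier G" for g h
    using second_centerD(2)[OF c2] that by blast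
  note ccD = center_le_center_cent[OF ccZ]
  have B: "sym_bichar B"
    unfolding sym_bichar_def linear_char_def
  proof (intro conjI ballI)
    fix g h k assume g: "g \<in> carrier G" and h: "h \<in> carrier G" and k: "k \<in> carrier G"
    show "B g h \<noteq> 0" unfolding B_def using \<mu>_root[OF ccD[OF g h]] root_of_unity_nonzero by blast
    show "B g h = B h g" unfolding B_def using commutator_commutator_sym[OF xD g h] by simp
    show "B (g \<otimes> k) h = B g h * B k h"
      unfolding B_def commutator_second_center_mult_left[OF g k c2[OF h]]
      using \<mu>_mult ccD g h k by blast
  qed
  have f: "quadratic f B"
    unfolding quadratic_def
  proof (intro conjI ballI)
    fix g h assume g: "g \<in> carrier G" and h: "h \<in> carrier G"
    show "root_of_unity (f g)" unfolding f_def using \<mu>_root[OF cD[OF g]] .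
    \<comment> \<open>\<open>commutator_mult_left\<close> becomes the quadratic law under \<mu>,
      since its three factors lie in \<open>center_cent\<close>.\<close>
    show "f (g \<otimes> h) = f g * f h * B g h"
      unfolding f_def B_def commutator_mult_left[OF g h xc]
      using \<mu>_mult[OF center_cent_mult[OF ccD[OF g h] cD[OF h]] cD[OF g]] \<mu>_mult[OF ccD[OF g h] cD[OF h]]
      by simp
  qed (rule B)
  \<comment> \<open>For h in the radical, every [g, [h, x]] is central with \<mu>-value 1, hence
    trivial. So [h, x] is central, and the goodness of x makes it trivial.\<close>
  have rad: "radical B = {h \<in> carrier G. h \<otimes> x = x \<otimes> h}"
  proof (intro equalityI subsetI)
    fix h assume h: "h \<in> radical B"
    have hc: "h \<in> carrier G" using h radicalD by blast
    have "commutator G h x \<otimes> g = g \<otimes> commutator G h x" if g: "g \<in> carrier G" for g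
    proof -
      have "commutator G g (commutator G h x) = \<one>"
        using \<mu>_center[OF ccZ[OF g hc]] radicalD(2)[OF h g] by (simp add: B_def)
      then show ?thesis using commutator_eq_one_iff[of g "commutator G h x"] g hc xc by simp
    qed
    then have "commutator G h x \<in> center" using hc xc by (simp add: center_def)
    then have "commutator G h x = \<one>" using x hc by (simp add: good_def)
    then show "h \<in> {h \<in> carrier G. h \<otimes> x = x \<otimes> h}"
      using commutator_eq_one_iff[OF hc xc] hc by simp
  next
    fix h assume "h \<in> {h \<in> carrier G. h \<otimes> x = x \<otimes> h}"
    then have h: "h \<in> carrier G" "commutator G h x = \<one>" using commutator_eq_one_iff xc by auto
    show "h \<in> radical B"
      by (rule radicalI) (use h \<mu>_one in \<open>auto simp: B_def commutator_def\<close>)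
  qed
  have f_rad: "f r = 1" if "r \<in> radical B" for r
    using that commutator_eq_one_iff[OF _ xc, of r] \<mu>_one unfolding rad f_def by auto
  let ?S = "\<Sum>g\<in>carrier G. f g"
  let ?C = "card {h \<in> carrier G. h \<otimes> x = x \<otimes> h}"
  let ?h = "card (conj_class G x)"
  have hC: "?h * ?C = ?N" using card_conj_class[OF xc] .
  have h0: "?h > 0" using card_conj_class_pos[OF xc] .
  \<comment> \<open>The squared absolute value is |G| times the order of the centralizer of x, which
    is |G|^2 / h(x) by orbit counting.\<close>
  have norm_S: "norm ?S * sqrt (real ?h) = real ?N"
  proof -
    have "(norm ?S * sqrt (real ?h))\<^sup>2 = (real ?N)\<^sup>2"
      using norm_quadratic_sum[OF f f_rad] hC unfolding rad
      by (simp add: power_mult_distrib power2_eq_square mult_ac flip: of_nat_mult)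
    then show ?thesis by simp
  qed
  have "root_of_unity_phase ?S"
    by (rule quadratic_sum_phase[OF f _ prime card_carrier]) (simp add: f_def \<mu>_card cD)
  then obtain w where w: "root_of_unity w" "?S = complex_of_real (norm ?S) * w"
    by (auto simp: root_of_unity_phase_def)
  \<comment> \<open>Writing g x g^-1 = [g, x] x splits off the constant factor \<mu>(x), itself a
    root of unity.\<close>
  have "(\<Sum>g\<in>carrier G. \<mu> (g \<otimes> x \<otimes> inv g)) = ?S * \<mu> x"
    unfolding sum_distrib_right
  proof (rule sum.cong[OF refl])
    fix g assume g: "g \<in> carrier G"
    have "g \<otimes> x \<otimes> inv g = commutator G g x \<otimes> x" using g xc by (simp add: commutator_def m_assoc)
    then show "\<mu> (g \<otimes> x \<otimes> inv g) = f g * \<mu> x" using \<mu>_mult[OF cD[OF g] xD] by (simp add: f_def)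
  qed
  then have "of_nat ?N * (chi x / of_nat n) = complex_of_real (norm ?S) * w * \<mu> x"
    using conj_sum w(2) by simp
  then have "of_nat ?N * (chi x / of_nat n) * complex_of_real (sqrt (real ?h))
      = complex_of_real (norm ?S * sqrt (real ?h)) * (w * \<mu> x)"
    by (simp add: mult_ac)
  then have "of_nat ?N * (chi x * complex_of_real (sqrt (real ?h)) / of_nat n) = of_nat ?N * (w * \<mu> x)"
    unfolding norm_S by (simp add: mult_ac)
  moreover have "of_nat ?N \<noteq> (0 :: complex)" using card_carrier_pos by simp
  ultimately have "chi x * complex_of_real (sqrt (real ?h)) / of_nat n = w * \<mu> x"
    using mult_left_cancel by blast
  then show "root_of_unity (chi x * complex_of_real (sqrt (real ?h)) / of_nat n)"
    using root_of_unity_mult[OF w(1) \<mu>_root[OF xD]] by simp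
qed

lemma good_iff_chi_nonzero: "x \<in> carrier G \<Longrightarrow> good x \<longleftrightarrow> chi x \<noteq> 0"
  using chi_nonzero_imp_good good_chi_value(2) root_of_unity_nonzero by fastforce

text \<open>In the orthogonality relation only good elements contribute, each with n^2 divided by
  the size of its class, so every good class adds n^2.\<close>

lemma card_classes_in_support:
  "of_nat n ^ 2 * of_nat (card {C \<in> conj_classes G. C \<subseteq> {x. good x}}) = (of_nat (card (carrier G)) :: complex)"
proof -
  let ?S = "{x. good x}"
  have S: "?S \<subseteq> carrier G" by (auto simp: good_def)
  have val: "chi x * chi (inv x) = of_nat n ^ 2 * (1 / of_nat (card (conj_class G x)))" if x: "good x" for x
  proof -
    have xc: "x \<in> carrier G" using x by (simp add: good_def)
    let ?h = "real (card (conj_class G x))"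
    have h: "?h > 0" using card_conj_class_pos[OF xc] by simp
    have "norm (chi x) * sqrt ?h = real n"
      using root_of_unity_norm[OF good_chi_value(2)[OF x]] by (auto simp: norm_mult norm_divide)
    then have "(norm (chi x) * sqrt ?h)\<^sup>2 = (real n)\<^sup>2" by simp
    then have "(norm (chi x))\<^sup>2 * ?h = (real n)\<^sup>2" by (simp add: power_mult_distrib)
    then have eq: "(norm (chi x))\<^sup>2 = (real n)\<^sup>2 * (1 / ?h)"
      using h by (metis divide_inverse mult_1 nonzero_eq_divide_eq order_less_irrefl)
    have "chi x * chi (inv x) = complex_of_real ((norm (chi x))\<^sup>2)"
      unfolding good_chi_value(1)[OF x] complex_norm_square ..
    then show ?thesis unfolding eq by simp
  qed
  have "(\<Sum>g\<in>carrier G. chi g * chi (inv g)) = (\<Sum>g\<in>?S. chi g * chi (inv g))"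
    using S finite_carrier good_iff_chi_nonzero by (intro sum.mono_neutral_right) auto
  also have "\<dots> = (\<Sum>g\<in>?S. of_nat n ^ 2 * (1 / of_nat (card (conj_class G g))))"
    using val by (intro sum.cong refl) simp
  also have "\<dots> = of_nat n ^ 2 * (\<Sum>g\<in>?S. 1 / of_nat (card (conj_class G g)))"
    by (rule sum_distrib_left[symmetric])
  also have "\<dots> = of_nat n ^ 2 * of_nat (card {C \<in> conj_classes G. C \<subseteq> ?S})"
    using sum_inverse_card_conj_class[OF S] good_conj by simp
  finally show ?thesis unfolding sum_chi_chi_inv by simp
qed

text \<open>As |G| is odd, adding it flips parity; so every integer exponent may be replaced by an
  odd natural one, which \<open>good_pow\<close> covers.\<close>

lemma odd_good_int_pow:
  assumes p: "odd p" and x: "good x"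
  shows "good (x [^] (m::int))"
proof -
  let ?N = "int (card (carrier G))"
  have xc: "x \<in> carrier G" using x by (simp add: good_def)
  have N: "odd ?N" "?N > 0" using p card_carrier card_carrier_pos by simp_all
  define j where "j = (if odd (m mod ?N) then m mod ?N else m mod ?N + ?N)"
  have j: "odd j" "j \<ge> 0" using N by (auto simp: j_def)
  have "x [^] ?N = \<one>"
    using pow_order_eq_1[OF xc] by (simp add: int_pow_int Coset.order_def)
  then have per: "x [^] (a + ?N * b) = x [^] a" for a b :: int
    using xc by (simp add: int_pow_mult flip: int_pow_pow)
  have "x [^] j = x [^] m"
  proof -
    have "m = j + ?N * (if odd (m mod ?N) then m div ?N else m div ?N - 1)"
      by (simp add: j_def algebra_simps)
    then show ?thesis using per by metis
  qed
  moreover have "x [^] j = x [^] nat j" using j(2) by (metis int_pow_int nat_0_le)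
  moreover have "odd (nat j)" using j by (simp add: even_nat_iff)
  ultimately show ?thesis using good_pow[OF x, of "nat j"] by simp
qed

text \<open>Distinct powers of x lie in distinct good classes, so \<open>ord x\<close> is at most
  the number of these. Both are powers of p, which turns the inequality into divisibility.\<close>

lemma odd_ord_dvd:
  assumes p: "odd p" and x: "good x"
  shows "ord x dvd card {C \<in> conj_classes G. C \<subseteq> {x. good x}}"
proof -
  let ?K = "{C \<in> conj_classes G. C \<subseteq> {x. good x}}"
  have xc: "x \<in> carrier G" using x by (simp add: good_def)
  have good_pow': "good (x [^] (j::nat))" for j
    using odd_good_int_pow[OF p x, of "int j"] by (simp add: int_pow_int)
  have pow_inj: "x [^] i = x [^] j" if eq: "conj_class G (x [^] i) = conj_class G (x [^] j)" for i j :: nat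
  proof -
    have "x [^] j \<in> conj_class G (x [^] i)" using conj_class_refl eq xc by simp
    then obtain y where y: "y \<in> carrier G" "x [^] j = y \<otimes> x [^] i \<otimes> inv y"
      using xc by (auto simp: conj_class_eq)
    \<comment> \<open>If y conjugates x^i to x^j, then [y, x^i] is a power of x, hence good. As a
      commutator it lies in the second center, so it is central, and then trivial because x^i is
      good.\<close>
    have "commutator G y (x [^] i) = x [^] j \<otimes> inv (x [^] i)"
      unfolding y(2) by (simp add: commutator_def)
    also have "\<dots> = x [^] (int j - int i)"
      using xc by (simp add: int_pow_diff int_pow_int)
    finally have "good (commutator G y (x [^] i))" using odd_good_int_pow[OF p x] by simp
    then have "commutator G y (x [^] i) \<in> center"
      using good_second_center_imp_center commutators_in_second_center[OF y(1)] xc by simp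
    then have "commutator G y (x [^] i) = \<one>"
      using good_pow'[of i] y(1) by (simp add: good_def)
    then have "y \<otimes> x [^] i = x [^] i \<otimes> y" using commutator_eq_one_iff y(1) xc by simp
    then show ?thesis using y commute_conj[OF y(1), of "x [^] i"] xc by simp
  qed
  have "inj_on (\<lambda>j. conj_class G (x [^] j)) {0..ord x - 1}"
    using ord_inj[OF xc] pow_inj by (auto simp: inj_on_def)
  moreover have "(\<lambda>j. conj_class G (x [^] j)) ` {0..ord x - 1} \<subseteq> ?K"
  proof -
    have "conj_class G (x [^] j) \<subseteq> {x. good x}" for j :: nat
      using good_conj[OF good_pow'[of j]] xc by (auto simp: conj_class_eq)
    then show ?thesis using xc by (auto simp: conj_classes_eq)
  qed
  ultimately have "card {0..ord x - 1} \<le> card ?K"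
    using finite_conj_classes by (intro card_inj_on_le) auto
  then have le: "ord x \<le> card ?K" by simp
  \<comment> \<open>The counting formula makes the number of good classes a divisor of |G|.\<close>
  have "n ^ 2 * card ?K = p ^ k"
  proof -
    have "of_nat (n ^ 2 * card ?K) = (of_nat (p ^ k) :: complex)"
      using card_classes_in_support by (simp add: card_carrier)
    then show ?thesis using of_nat_eq_iff by blast
  qed
  then have "card ?K dvd p ^ k" by (metis dvd_triv_right)
  then obtain a where a: "card ?K = p ^ a" using prime by (auto simp: divides_primepow_nat)
  have "ord x dvd p ^ k" using ord_dvd_group_order[OF xc] card_carrier by (simp add: Coset.order_def)
  then obtain b where b: "ord x = p ^ b" using prime by (auto simp: divides_primepow_nat)
  have "b \<le> a" using le a b prime prime_gt_1_nat power_le_imp_le_exp by metis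
  then show ?thesis using a b le_imp_power_dvd by simp
qed

end

section \<open>Nilpotency class, kernels and the image of the representation\<close>

lemma group_class3_if_nilpotent:
  assumes G: "group G" and nil: "nilpotent_class_le G 3"
  shows "group_class3 G"
proof -
  interpret group G by (rule G)
  have step: "commutator G a b \<in> lower_central G (Suc i)"
    if "a \<in> lower_central G i" "b \<in> carrier G" for a b i
    unfolding lower_central.simps commutator_subgroup_def commutator_def
    using that by (intro generate.incl) blast
  have comm: "commutator G (commutator G (commutator G a b) g) h = \<one>\<^bsub>G\<^esub>"
    if "a \<in> carrier G" "b \<in> carrier G" "g \<in> carrier G" "h \<in> carrier G" for a b g h
  proof -
    have "commutator G (commutator G (commutator G a b) g) h \<in> lower_central G (Suc (Suc (Suc 0)))"
      using that by (intro step) simp_all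
    then show ?thesis using nil by (simp only: nilpotent_class_le_def numeral_3_eq_3 singleton_iff)
  qed
  have "commutator G g (commutator G a b) \<in> center"
    if abg: "a \<in> carrier G" "b \<in> carrier G" "g \<in> carrier G" for a b g
  proof -
    have "commutator G (commutator G a b) g \<in> center"
      unfolding center_def using abg comm[OF abg] commutator_eq_one_iff by simp
    \<comment> \<open>The definition of \<open>second_center\<close> has the commutator in the other
      order, which amounts to inversion.\<close>
    from center_inv[OF this] show ?thesis using commutator_inv abg by simp
  qed
  then show ?thesis
    by unfold_locales (simp add: second_center_def)
qed

lemma (in group_hom) hom_commutator:
  "a \<in> carrier G \<Longrightarrow> b \<in> carrier G \<Longrightarrow> h (commutator G a b) = commutator H (h a) (h b)"
  by (simp add: commutator_def)

lemma (in group_hom) surj_center: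
  assumes "h ` carrier G = carrier H" "z \<in> G.center"
  shows "h z \<in> H.center"
proof -
  have z: "z \<in> carrier G" using assms(2) G.centerD by blast
  have "h z \<otimes>\<^bsub>H\<^esub> h g = h g \<otimes>\<^bsub>H\<^esub> h z" if "g \<in> carrier G" for g
    using G.centerD(2)[OF assms(2) that] z that by (metis hom_mult)
  then show ?thesis using z assms(1) unfolding H.center_def by (auto simp flip: assms(1))
qed

text \<open>Surjectivity lifts each double commutator of H to one of G, where it is central, and
  carries the center of G into that of H.\<close>

lemma (in group_hom) surj_group_class3:
  assumes surj: "h ` carrier G = carrier H" and G3: "group_class3 G"
  shows "group_class3 H"
proof -
  interpret G3: group_class3 G by (rule G3)
  show ?thesis
  proof unfold_locales
    fix a b assume "a \<in> carrier H" "b \<in> carrier H"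
    then obtain a' b' where ab: "a' \<in> carrier G" "b' \<in> carrier G" "a = h a'" "b = h b'"
      unfolding surj[symmetric] by blast
    have "commutator H g (commutator H a b) \<in> H.center" if "g \<in> carrier H" for g
    proof -
      have "g \<in> h ` carrier G" using that surj by simp
      then obtain g' where g: "g = h g'" "g' \<in> carrier G" by (rule imageE)
      have "commutator H g (commutator H a b) = h (commutator G g' (commutator G a' b'))"
        using ab g by (simp add: hom_commutator)
      then show ?thesis
        using surj_center[OF surj G.second_centerD(2)[OF G3.commutators_in_second_center[OF ab(1,2)] g(2)]]
        by simp
    qed
    then show "commutator H a b \<in> H.second_center"
      using ab by (simp add: H.second_center_def)
  qed
qed

lemma (in group_hom) card_kernel_mult_image:
  assumes "h ` carrier G = carrier H"
  shows "card (kernel G H h) * card (carrier H) = card (carrier G)"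
proof -
  have "bij_betw (\<lambda>X. the_elem (h ` X)) (carrier (G Mod kernel G H h)) (carrier H)"
    using FactGroup_iso_set[OF assms] by (simp add: iso_def)
  then have "card (rcosets\<^bsub>G\<^esub> (kernel G H h)) = card (carrier H)"
    using bij_betw_same_card by (auto simp: FactGroup_def)
  then show ?thesis
    using G.lagrange[OF subgroup_kernel] by (simp add: Coset.order_def mult.commute)
qed

lemma (in group) pow_card_subgroup:
  assumes "subgroup H G" "y \<in> H"
  shows "y [^] card H = \<one>"
proof -
  interpret S: subgroup H G by (rule assms(1))
  interpret H: group "G\<lparr>carrier := H\<rparr>" by (rule S.subgroup_is_group[OF is_group])
  have "y [^]\<^bsub>G\<lparr>carrier := H\<rparr>\<^esub> card H = \<one>"
    using H.pow_order_eq_1[of y] assms(2) by (simp add: Coset.order_def)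
  then show ?thesis by (simp add: nat_pow_def)
qed

text \<open>Raising x to the order of its image lands in the kernel, whose order kills the
  result.\<close>

lemma (in group_hom) ord_dvd_card_kernel_mult_ord:
  assumes "x \<in> carrier G"
  shows "G.ord x dvd card (kernel G H h) * H.ord (h x)"
proof -
  have "h (x [^]\<^bsub>G\<^esub> H.ord (h x)) = \<one>\<^bsub>H\<^esub>"
    using assms by (simp add: hom_nat_pow H.pow_ord_eq_1)
  then have "x [^]\<^bsub>G\<^esub> H.ord (h x) \<in> kernel G H h"
    using assms by (simp add: kernel_def)
  then have "(x [^]\<^bsub>G\<^esub> H.ord (h x)) [^]\<^bsub>G\<^esub> card (kernel G H h) = \<one>\<^bsub>G\<^esub>"
    by (rule G.pow_card_subgroup[OF subgroup_kernel])
  then have "x [^]\<^bsub>G\<^esub> (H.ord (h x) * card (kernel G H h)) = \<one>\<^bsub>G\<^esub>"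
    using assms by (simp add: G.nat_pow_pow)
  then show ?thesis
    using G.pow_eq_id[OF assms] by (simp add: mult.commute)
qed

lemma (in irreducible_rep) inj_rep_if_faithful_char:
  assumes "faithful_char G (character G \<rho>)"
  shows "inj_on \<rho> (carrier G)"
proof (rule inj_onI)
  fix a b assume a: "a \<in> carrier G" and b: "b \<in> carrier G" and eq: "\<rho> a = \<rho> b"
  have "\<rho> (a \<otimes> inv b) = \<rho> \<one>"
    using a b eq rep_inv(1)[OF b] by (simp add: rep_mult rep_one)
  then have "a \<otimes> inv b \<in> char_kernel G (character G \<rho>)"
    using a b by (simp add: char_kernel_def character_def)
  then have "a \<otimes> inv b = \<one>" using assms by (simp add: faithful_char_def)
  then show "a = b" using a b by (metis inv_equality inv_inv inv_closed)
qed

text \<open>The image acts on the same space by the identity map, with the same invariant subspaces.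
  This gives an injective representation for an arbitrary character.\<close>

lemma (in irreducible_rep) image_irreducible_rep:
  fixes Q defines "Q \<equiv> (GL_complex n)\<lparr>carrier := \<rho> ` carrier G\<rparr>"
  shows "group_hom G Q \<rho>" "irreducible_rep Q n (\<lambda>A. A)"
proof -
  have GL: "group (GL_complex n)"
    by (rule monoid.units_group) (rule ring.is_monoid[OF ring_mat])
  interpret GL: group_hom G "GL_complex n" \<rho>
    using rep_hom GL is_group by (simp add: group_hom_def group_hom_axioms_def)
  have sub: "subgroup (\<rho> ` carrier G) (GL_complex n)" by (rule GL.img_is_subgroup[simplified])
  have Q: "group Q" unfolding Q_def by (rule subgroup.subgroup_is_group[OF sub GL])
  have hom: "\<rho> \<in> hom G Q" using rep_hom by (auto simp: hom_def Q_def)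
  show "group_hom G Q \<rho>"
    using Q hom is_group by (simp add: group_hom_def group_hom_axioms_def)
  have "representation Q n (\<lambda>A. A)"
    using subgroup.subset[OF sub] by (auto simp: representation_def hom_def Q_def)
  moreover have "invariant_subspace G n \<rho> W" if "invariant_subspace Q n (\<lambda>A. A) W" for W
    using that by (simp add: invariant_subspace_def Q_def)
  ultimately have "irreducible_representation Q n (\<lambda>A. A)"
    using irreducible by (auto simp: irreducible_representation_def)
  moreover have "finite (carrier Q)" using finite_carrier by (simp add: Q_def)
  ultimately show "irreducible_rep Q n (\<lambda>A. A)"
    using Q by (simp add: irreducible_rep_def irreducible_rep_axioms_def finite_group_def finite_group_axioms_def)
qed

lemma (in irreducible_rep) character_eq_chi: "g \<in> carrier G \<Longrightarrow> character G \<rho> g = chi g"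
  by (simp add: character_def chi_def)

section \<open>The four statements\<close>

theorem theoremB:
  fixes P :: "('a, 'b) monoid_scheme" and p :: nat and \<chi> :: "'a \<Rightarrow> complex" and x :: 'a
  assumes "prime p" and "p_group p P" and "nilpotent_class_le P 3"
    and "\<chi> \<in> Irr P" and "x \<in> Supp P \<chi>"
  shows "(faithful_char P \<chi> \<longrightarrow>
            root_of_unity (\<chi> x * complex_of_real (sqrt (real (card (conj_class P x)))) / \<chi> \<one>\<^bsub>P\<^esub>))
       \<and> (faithful_char P \<chi> \<longrightarrow>
            of_nat (card {C \<in> conj_classes P. C \<subseteq> Supp P \<chi>})
              = of_nat (Coset.order P) / (\<chi> \<one>\<^bsub>P\<^esub>)\<^sup>2)
       \<and> (odd p \<longrightarrow> (\<forall>m::int. x [^]\<^bsub>P\<^esub> m \<in> Supp P \<chi>))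
       \<and> (odd p \<longrightarrow>
            (\<exists>k::nat. of_nat k = of_nat (Coset.order P) / (\<chi> \<one>\<^bsub>P\<^esub>)\<^sup>2 \<and> group.ord P x dvd k))"
proof -
  from assms(4) obtain n \<rho> where irr: "irreducible_representation P n \<rho>" and \<chi>: "\<chi> = character P \<rho>"
    by (auto simp: Irr_def)
  from assms(2) obtain k where P: "group P" "finite (carrier P)" "card (carrier P) = p ^ k"
    by (auto simp: p_group_def Coset.order_def)
  interpret P: irreducible_rep P n \<rho>
    using P irr by (simp add: irreducible_rep_def irreducible_rep_axioms_def finite_group_def finite_group_axioms_def)
  have class3: "group_class3 P" using group_class3_if_nilpotent[OF P(1) assms(3)] .
  have x: "x \<in> carrier P" and chi_x: "P.chi x \<noteq> 0"
    using assms(5) P.character_eq_chi by (auto simp: Supp_def \<chi>)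
  have \<chi>_one: "\<chi> \<one>\<^bsub>P\<^esub> = of_nat n" by (simp add: \<chi> P.character_eq_chi P.chi_one)
  have Supp: "g \<in> Supp P \<chi> \<longleftrightarrow> g \<in> carrier P \<and> P.chi g \<noteq> 0" for g
    using P.character_eq_chi by (auto simp: Supp_def \<chi>)
  have n: "of_nat n \<noteq> (0 :: complex)" using P.dim_pos by simp

  have faithful: "root_of_unity (\<chi> x * complex_of_real (sqrt (real (card (conj_class P x)))) / \<chi> \<one>\<^bsub>P\<^esub>)
      \<and> of_nat (card {C \<in> conj_classes P. C \<subseteq> Supp P \<chi>}) = of_nat (Coset.order P) / (\<chi> \<one>\<^bsub>P\<^esub>)\<^sup>2"
    if "faithful_char P \<chi>"
  proof -
    interpret F: faithful_class3_rep P n \<rho> p k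
      using P.irreducible_rep_axioms class3 P.inj_rep_if_faithful_char that assms(1) P(3)
      by (simp add: faithful_class3_rep_def faithful_class3_rep_axioms_def \<chi>)
    have "Supp P \<chi> = {g. P.good g}"
      using Supp P.good_def F.good_iff_chi_nonzero by blast
    then have "of_nat n ^ 2 * of_nat (card {C \<in> conj_classes P. C \<subseteq> Supp P \<chi>}) = (of_nat (card (carrier P)) :: complex)"
      using F.card_classes_in_support by simp
    then have "of_nat (card {C \<in> conj_classes P. C \<subseteq> Supp P \<chi>}) = of_nat (Coset.order P) / (\<chi> \<one>\<^bsub>P\<^esub>)\<^sup>2"
      using n by (simp add: \<chi>_one Coset.order_def field_simps)
    then show ?thesis
      using F.good_chi_value(2) F.chi_nonzero_imp_good[OF x chi_x] \<chi>_one P.character_eq_chi[OF x] \<chi>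
      by simp
  qed

  \<comment> \<open>The last two statements concern arbitrary characters. They are transferred from
    the image Q, whose identity representation is injective and has character value chi(g) at
    \<open>\<rho> g\<close>.\<close>
  define Q where "Q = (GL_complex n)\<lparr>carrier := \<rho> ` carrier P\<rparr>"
  interpret Q: irreducible_rep Q n "\<lambda>A. A" unfolding Q_def by (rule P.image_irreducible_rep(2))
  interpret h: group_hom P Q \<rho> unfolding Q_def by (rule P.image_irreducible_rep(1))
  have surj: "\<rho> ` carrier P = carrier Q" by (simp add: Q_def)
  have kerQ: "card (kernel P Q \<rho>) * card (carrier Q) = card (carrier P)"
    by (rule h.card_kernel_mult_image[OF surj])
  then have "card (carrier Q) dvd p ^ k" using P(3) by (metis dvd_triv_right)
  then obtain j where j: "card (carrier Q) = p ^ j" using assms(1) by (auto simp: divides_primepow_nat)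
  interpret Q: faithful_class3_rep Q n "\<lambda>A. A" p j
    using Q.irreducible_rep_axioms h.surj_group_class3[OF surj class3] assms(1) j
    by (simp add: faithful_class3_rep_def faithful_class3_rep_axioms_def)
  have chi_Q: "Q.chi (\<rho> g) = P.chi g" for g by (simp add: Q.chi_def P.chi_def)
  have good: "Q.good (\<rho> x)"
    using Q.good_iff_chi_nonzero chi_x x h.hom_closed by (simp add: chi_Q)
  have 3: "x [^]\<^bsub>P\<^esub> m \<in> Supp P \<chi>" if "odd p" for m :: int
  proof -
    have "\<rho> (x [^]\<^bsub>P\<^esub> m) = \<rho> x [^]\<^bsub>Q\<^esub> m" using h.hom_int_pow[OF x] .
    then have "Q.good (\<rho> (x [^]\<^bsub>P\<^esub> m))" using Q.odd_good_int_pow[OF that good, of m] by simp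
    then show ?thesis
      using Q.good_iff_chi_nonzero h.hom_closed x by (simp add: Supp chi_Q)
  qed
  have 4: "\<exists>k::nat. of_nat k = of_nat (Coset.order P) / (\<chi> \<one>\<^bsub>P\<^esub>)\<^sup>2 \<and> group.ord P x dvd k" if "odd p"
  proof -
    \<comment> \<open>|P| / chi(1)^2 is the order of the kernel times the number of good classes of
      Q. The order of x divides the order of the kernel times the order of \<open>\<rho> x\<close>,
      and the latter divides that number.\<close>
    let ?c = "card {C \<in> conj_classes Q. C \<subseteq> {x. Q.good x}}"
    let ?K = "card (kernel P Q \<rho>)"
    have "of_nat n ^ 2 * of_nat (?K * ?c) = (of_nat ?K * of_nat (card (carrier Q)) :: complex)"
      using Q.card_classes_in_support by simp
    also have "\<dots> = of_nat (Coset.order P)"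
      using kerQ by (simp add: Coset.order_def flip: of_nat_mult)
    finally have "of_nat (?K * ?c) = of_nat (Coset.order P) / (\<chi> \<one>\<^bsub>P\<^esub>)\<^sup>2"
      using n by (simp add: \<chi>_one field_simps)
    moreover have "group.ord P x dvd ?K * ?c"
      using h.ord_dvd_card_kernel_mult_ord[OF x] Q.odd_ord_dvd[OF that good] dvd_trans mult_dvd_mono dvd_refl
      by meson
    ultimately show ?thesis by blast
  qed
  show ?thesis using faithful 3 4 by blast
qed

end
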